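(* Let $k\ge 2$, and let $\Gamma_{M_{k,1}}\cup\{\tau_{i,j}:1\le i<j\}$ and $\Gamma_{lepM_{k,1}}\cup\{\tau_{i,j}:1\le i<j\}$ be generating sets of the monoids $M_{k,1}$ and $lepM_{k,1}$ respectively, where $\Gamma_{M_{k,1}}$ and $\Gamma_{lepM_{k,1}}$ are finite. Let $|x|_{M_{k,1}}$ and $|x|_{lepM_{k,1}}$ denote the word-length of $x$ over these respective generating sets. Then the word-length (Cayley graph) distortion of $lepM_{k,1}$ in $M_{k,1}$ has a quadratic upper bound; in other words, there is a constant $c\ge 1$ such that for all $x\in lepM_{k,1}$: $$|x|_{lepM_{k,1}}\ \le\ c\cdot\big(|x|_{M_{k,1}}\big)^2 .$$
   Context: Let $A$ be an ordered alphabet of size $k\ge2$, $A^*$ the set of finite words over $A$, and $|w|$ the length of $w$. A right ideal is a set $R\subseteq A^*$ with $RA^*\subseteq R$. A prefix code is a set of words none of which is a prefix of another one; it is maximal if it is not a strict subset of another prefix code. A right-ideal homomorphism is a total function $\varphi:R_1\to A^*$ on a right ideal $R_1={\rm Dom}(\varphi)$ such that $\varphi(rz)=\varphi(r)z$ for all $r\in R_1$, $z\in A^*$; its image is a right ideal. A right ideal $R'\subseteq R$ is essential in $R$ iff $R'$ meets every right ideal that $R$ meets. $\Phi$ is an essential restriction of $\varphi$ (and $\varphi$ an essential extension of $\Phi$) iff $\Phi$ is a restriction of $\varphi$ to a right ideal that is essential in ${\rm Dom}(\varphi)$. Every homomorphism $\varphi$ between finitely generated right ideals has a unique maximal essential extension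 $\max(\varphi)$; $\varphi$ is said to represent $\max(\varphi)$. The monoid $M_{k,1}$ consists of all maximum essential extensions of homomorphisms between finitely generated right ideals of $A^*$, with product $\varphi\cdot\psi=\max(\varphi\circ\psi)$. The submonoid $lepM_{k,1}$ consists of the elements of $M_{k,1}$ represented by a right-ideal homomorphism $\varphi:PA^*\to QA^*$, with $P,Q$ finite prefix codes and $P$ maximal, such that for all $x_1,x_2\in{\rm Dom}(\varphi)$: $|x_1|=|x_2|$ implies $|\varphi(x_1)|=|\varphi(x_2)|$. The position transposition $\tau_{i,j}$ is the map $ux_ivx_jw\mapsto ux_jvx_iw$, where $u,v,w\in A^*$, $|u|=i-1$, $|v|=j-i-1$, $x_i,x_j\in A$. Word-length of an element over a generating set is the minimum length of a word over this set representing the element. *)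

theory Defs
  imports Complex_Main "HOL-Library.Sublist" "HOL-Library.Cardinality" "HOL-Algebra.Group"
begin

text \<open>The finite alphabet is a type \<^typ>\<open>'a\<close>, words are lists over it, and a partial function on
  words is a map \<^typ>\<open>'a list \<rightharpoonup> 'a list\<close>.\<close>

definition right_ideal :: "'a list set \<Rightarrow> bool" where
  "right_ideal R \<longleftrightarrow> (\<forall>r\<in>R. \<forall>z. r @ z \<in> R)"

definition ideal_of :: "'a list set \<Rightarrow> 'a list set" where
  "ideal_of P = {p @ z |p z. p \<in> P}"

definition fg_right_ideal :: "'a list set \<Rightarrow> bool" where
  "fg_right_ideal R \<longleftrightarrow> (\<exists>P. finite P \<and> R = ideal_of P)"

definition prefix_code :: "'a list set \<Rightarrow> bool" where
  "prefix_code P \<longleftrightarrow> (\<forall>p\<in>P. \<forall>q\<in>P. prefix p q \<longrightarrow> p = q)"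

definition maximal_prefix_code :: "'a list set \<Rightarrow> bool" where
  "maximal_prefix_code P \<longleftrightarrow> prefix_code P \<and> (\<forall>P'. prefix_code P' \<longrightarrow> \<not> P \<subset> P')"

definition ri_hom :: "('a list \<rightharpoonup> 'a list) \<Rightarrow> bool" where
  "ri_hom \<phi> \<longleftrightarrow> right_ideal (dom \<phi>) \<and>
     (\<forall>r\<in>dom \<phi>. \<forall>z. the (\<phi> (r @ z)) = the (\<phi> r) @ z)"

definition fg_ri_hom :: "('a list \<rightharpoonup> 'a list) \<Rightarrow> bool" where
  "fg_ri_hom \<phi> \<longleftrightarrow> ri_hom \<phi> \<and> fg_right_ideal (dom \<phi>) \<and> fg_right_ideal (ran \<phi>)"

definition essential_in :: "'a list set \<Rightarrow> 'a list set \<Rightarrow> bool" where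
  "essential_in R' R \<longleftrightarrow> right_ideal R' \<and> R' \<subseteq> R \<and>
     (\<forall>J. right_ideal J \<longrightarrow> R \<inter> J \<noteq> {} \<longrightarrow> R' \<inter> J \<noteq> {})"

text \<open>The second argument is an essential extension of the first one.\<close>

definition essential_extension :: "('a list \<rightharpoonup> 'a list) \<Rightarrow> ('a list \<rightharpoonup> 'a list) \<Rightarrow> bool" where
  "essential_extension \<Phi> \<phi> \<longleftrightarrow> ri_hom \<phi> \<and> (\<exists>R. essential_in R (dom \<phi>) \<and> \<Phi> = \<phi> |` R)"

definition maximal_essential_extension :: "('a list \<rightharpoonup> 'a list) \<Rightarrow> ('a list \<rightharpoonup> 'a list) \<Rightarrow> bool" where
  "maximal_essential_extension \<Phi> \<phi> \<longleftrightarrow> essential_extension \<Phi> \<phi> \<and>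
     (\<forall>\<psi>. essential_extension \<Phi> \<psi> \<longrightarrow> \<phi> \<subseteq>\<^sub>m \<psi> \<longrightarrow> \<psi> = \<phi>)"

definition max_ext :: "('a list \<rightharpoonup> 'a list) \<Rightarrow> ('a list \<rightharpoonup> 'a list)" where
  "max_ext \<Phi> = (THE \<phi>. maximal_essential_extension \<Phi> \<phi>)"

definition M_k1 :: "('a list \<rightharpoonup> 'a list) monoid" where
  "M_k1 = \<lparr>carrier = {max_ext \<phi> |\<phi>. fg_ri_hom \<phi>},
           monoid.mult = (\<lambda>\<phi> \<psi>. max_ext (\<phi> \<circ>\<^sub>m \<psi>)), one = Some\<rparr>"

definition length_equality_preserving :: "('a list \<rightharpoonup> 'a list) \<Rightarrow> bool" where
  "length_equality_preserving \<phi> \<longleftrightarrow>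
     (\<forall>x\<in>dom \<phi>. \<forall>y\<in>dom \<phi>. length x = length y \<longrightarrow> length (the (\<phi> x)) = length (the (\<phi> y)))"

text \<open>A homomorphism "from PA* to QA*" is read as one with image QA*.  Every homomorphism with domain
  PA* for a finite \<^term>\<open>P\<close> has image QA* for some finite prefix code \<^term>\<open>Q\<close>, so this is no restriction.\<close>

definition lepM_k1 :: "('a list \<rightharpoonup> 'a list) monoid" where
  "lepM_k1 = M_k1\<lparr>carrier := {x \<in> carrier M_k1. \<exists>\<phi> P Q.
     finite P \<and> maximal_prefix_code P \<and> finite Q \<and> prefix_code Q \<and>
     ri_hom \<phi> \<and> dom \<phi> = ideal_of P \<and> ran \<phi> = ideal_of Q \<and>
     length_equality_preserving \<phi> \<and> x = max_ext \<phi>}\<rparr>"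

text \<open>Positions are counted from 1, list indices from 0.\<close>

definition pos_transposition :: "nat \<Rightarrow> nat \<Rightarrow> 'a list \<rightharpoonup> 'a list" where
  "pos_transposition i j w =
     (if j \<le> length w then Some (w[i - 1 := w ! (j - 1), j - 1 := w ! (i - 1)]) else None)"

definition pos_transpositions :: "('a list \<rightharpoonup> 'a list) set" where
  "pos_transpositions = {pos_transposition i j |i j. 1 \<le> i \<and> i < j}"

text \<open>The empty word represents the identity.\<close>

definition word_value :: "('b, 'm) monoid_scheme \<Rightarrow> 'b list \<Rightarrow> 'b" where
  "word_value G ws = foldr (\<lambda>x y. x \<otimes>\<^bsub>G\<^esub> y) ws \<one>\<^bsub>G\<^esub>"

definition generating_set :: "('b, 'm) monoid_scheme \<Rightarrow> 'b set \<Rightarrow> bool" where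
  "generating_set G S \<longleftrightarrow> S \<subseteq> carrier G \<and> word_value G ` lists S = carrier G"

definition word_length :: "('b, 'm) monoid_scheme \<Rightarrow> 'b set \<Rightarrow> 'b \<Rightarrow> nat" where
  "word_length G S x = (LEAST n. \<exists>ws\<in>lists S. length ws = n \<and> word_value G ws = x)"

text \<open>Well-definedness of \<^const>\<open>max_ext\<close>.\<close>

lemma ri_hom_append:
  assumes "ri_hom \<phi>" "\<phi> r = Some s"
  shows "\<phi> (r @ z) = Some (s @ z)"
proof -
  have r: "r \<in> dom \<phi>" using assms(2) by blast
  then have "r @ z \<in> dom \<phi>" "the (\<phi> (r @ z)) = the (\<phi> r) @ z"
    using assms(1) unfolding ri_hom_def right_ideal_def by blast+
  then show ?thesis using assms(2) by auto
qed

lemma essential_extensionD: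
  assumes "essential_extension \<Phi> \<chi>" "\<chi> w = Some s"
  shows "\<exists>z t. \<Phi> (w @ z) = Some t \<and> t = s @ z"
proof -
  obtain R where R: "essential_in R (dom \<chi>)" "\<Phi> = \<chi> |` R" and h: "ri_hom \<chi>"
    using assms(1) unfolding essential_extension_def by blast
  have "right_ideal {w @ z |z. True}" unfolding right_ideal_def by auto
  moreover have "dom \<chi> \<inter> {w @ z |z. True} \<noteq> {}" using assms(2) by force
  ultimately have "R \<inter> {w @ z |z. True} \<noteq> {}" using R(1) unfolding essential_in_def by blast
  then obtain z where "w @ z \<in> R" by blast
  then show ?thesis using ri_hom_append[OF h assms(2)] R(2) by (metis restrict_in)
qed

lemma essential_extension_map_le: "essential_extension \<Phi> \<chi> \<Longrightarrow> \<Phi> \<subseteq>\<^sub>m \<chi>"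
  unfolding essential_extension_def by (auto simp: map_le_def restrict_map_def split: if_splits)

lemma essential_extension_unique:
  assumes "essential_extension \<Phi> \<chi>" "essential_extension \<Phi> \<chi>'" "\<chi> w = Some s" "\<chi>' w = Some s'"
  shows "s = s'"
proof -
  obtain z where z: "\<Phi> (w @ z) = Some (s @ z)" using essential_extensionD[OF assms(1,3)] by blast
  have "ri_hom \<chi>'" using assms(2) unfolding essential_extension_def by blast
  then have "\<chi>' (w @ z) = Some (s' @ z)" using assms(4) ri_hom_append by blast
  moreover have "\<chi>' (w @ z) = Some (s @ z)"
    using essential_extension_map_le[OF assms(2)] z unfolding map_le_def by (metis domI)
  ultimately show ?thesis by simp
qed

lemma maximal_essential_extension_ex1:
  assumes "ri_hom \<Phi>"
  shows "\<exists>!\<phi>. maximal_essential_extension \<Phi> \<phi>"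
proof -
  define \<mu> where "\<mu> w = (if \<exists>\<chi>. essential_extension \<Phi> \<chi> \<and> w \<in> dom \<chi>
     then (SOME \<chi>. essential_extension \<Phi> \<chi> \<and> w \<in> dom \<chi>) w else None)" for w
  have mu1: "\<mu> w = Some s" if "essential_extension \<Phi> \<chi>" "\<chi> w = Some s" for \<chi> w s
  proof -
    let ?c = "SOME \<chi>. essential_extension \<Phi> \<chi> \<and> w \<in> dom \<chi>"
    have ex: "\<exists>\<chi>. essential_extension \<Phi> \<chi> \<and> w \<in> dom \<chi>" using that by blast
    have c: "essential_extension \<Phi> ?c \<and> w \<in> dom ?c" by (rule someI_ex[OF ex])
    then obtain s' where s': "?c w = Some s'" by blast
    then have "s' = s" using essential_extension_unique c that by blast
    then show ?thesis using ex s' unfolding \<mu>_def by simp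
  qed
  have mu2: "\<exists>\<chi>. essential_extension \<Phi> \<chi> \<and> \<chi> w = Some s" if "\<mu> w = Some s" for w s
  proof -
    let ?c = "SOME \<chi>. essential_extension \<Phi> \<chi> \<and> w \<in> dom \<chi>"
    have ex: "\<exists>\<chi>. essential_extension \<Phi> \<chi> \<and> w \<in> dom \<chi>"
      using that unfolding \<mu>_def by (auto split: if_splits)
    then have "essential_extension \<Phi> ?c" using someI_ex[OF ex] by blast
    moreover have "?c w = Some s" using that ex unfolding \<mu>_def by simp
    ultimately show ?thesis by blast
  qed
  have le: "\<chi> \<subseteq>\<^sub>m \<mu>" if "essential_extension \<Phi> \<chi>" for \<chi>
    using mu1[OF that] unfolding map_le_def by fastforce
  have app: "\<mu> (w @ z) = Some (s @ z)" if w: "\<mu> w = Some s" for w s z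
  proof -
    obtain \<chi> where \<chi>: "essential_extension \<Phi> \<chi>" "\<chi> w = Some s" using mu2[OF w] by blast
    then have "ri_hom \<chi>" unfolding essential_extension_def by blast
    then show ?thesis using mu1[OF \<chi>(1)] ri_hom_append \<chi>(2) by blast
  qed
  have hom: "ri_hom \<mu>"
    unfolding ri_hom_def right_ideal_def using app by fastforce
  have id: "right_ideal (dom \<Phi>)" using assms unfolding ri_hom_def by blast
  have refl: "essential_extension \<Phi> \<Phi>"
    unfolding essential_extension_def essential_in_def using assms id
    by (intro conjI exI[of _ "dom \<Phi>"]) (auto simp: restrict_map_def fun_eq_iff domIff)
  have "essential_in (dom \<Phi>) (dom \<mu>)"
    unfolding essential_in_def
  proof (intro conjI allI impI id)
    show "dom \<Phi> \<subseteq> dom \<mu>" using le[OF refl] by (rule map_le_implies_dom_le)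
    fix J :: "'a list set" assume J: "right_ideal J" "dom \<mu> \<inter> J \<noteq> {}"
    then obtain w s where w: "w \<in> J" "\<mu> w = Some s" by blast
    obtain z where "w @ z \<in> dom \<Phi>" using mu2[OF w(2)] essential_extensionD by blast
    then show "dom \<Phi> \<inter> J \<noteq> {}" using J(1) w(1) unfolding right_ideal_def by blast
  qed
  moreover have "\<Phi> = \<mu> |` dom \<Phi>"
    using le[OF refl] by (auto simp: map_le_def restrict_map_def fun_eq_iff domIff)
  ultimately have mu: "essential_extension \<Phi> \<mu>"
    using hom unfolding essential_extension_def by blast
  show ?thesis
  proof (rule ex1I[of _ \<mu>])
    show "maximal_essential_extension \<Phi> \<mu>"
      unfolding maximal_essential_extension_def using mu le map_le_antisym by blast
    show "\<phi> = \<mu>" if "maximal_essential_extension \<Phi> \<phi>" for \<phi>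
      using that mu le unfolding maximal_essential_extension_def by blast
  qed
qed

end

theory Submission
  imports Defs
begin

text \<open>Let \<open>x\<close> be the value of a word of length \<open>n\<close> over the generators of the big monoid. Replacing each
  generator by a finitely generated representative and composing without maximization gives a map that
  agrees with \<open>x\<close> on all long inputs, and elements of the monoid are determined by their values on long
  inputs. The composition is simulated by length-preserving maps: the current word \<open>w\<close> is stored as
  \<open>0\<^sup>m1w\<close>, where \<open>m\<close> absorbs the data-dependent change of length, which is \<open>O(n)\<close>. To apply one generator,
  all \<open>O(n)\<close> possible positions of the marker \<open>1\<close> are scanned; at each position a gate taken from a finite
  set acts on boundedly many cells, brought to the front by position transpositions. This gives \<open>O(n\<^sup>2)\<close>
  generators. Because \<open>x\<close> is length-equality preserving, the final \<open>m\<close> is the same for all inputs, so the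
  padding can be removed by deleting a fixed number of letters.\<close>

section \<open>Essential extensions and values on long words\<close>

text \<open>A right ideal that meets the domain of \<open>\<chi>\<close> in w contains every w z, so
  it suffices that each such w has an extension in the domain of \<open>\<Phi>\<close>.\<close>

lemma essential_extensionI:
  assumes "ri_hom \<chi>" "right_ideal (dom \<Phi>)" "\<Phi> \<subseteq>\<^sub>m \<chi>" "\<And>w. w \<in> dom \<chi> \<Longrightarrow> \<exists>z. w @ z \<in> dom \<Phi>"
  shows "essential_extension \<Phi> \<chi>"
  unfolding essential_extension_def
proof (intro conjI exI)
  show "essential_in (dom \<Phi>) (dom \<chi>)"
    unfolding essential_in_def
  proof (intro conjI allI impI)
    fix J assume "right_ideal J" "dom \<chi> \<inter> J \<noteq> {}"
    then show "dom \<Phi> \<inter> J \<noteq> {}" using assms(4) unfolding right_ideal_def by blast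
  qed (use assms in \<open>auto simp: map_le_implies_dom_le\<close>)
  show "\<Phi> = \<chi> |` dom \<Phi>"
    using assms(3) by (auto simp: map_le_def restrict_map_def fun_eq_iff domIff)
qed (rule assms)

lemma essential_extension_dom:
  assumes "essential_extension \<Phi> \<chi>"
  shows "ri_hom \<chi>" "right_ideal (dom \<Phi>)" "w \<in> dom \<chi> \<Longrightarrow> \<exists>z. w @ z \<in> dom \<Phi>"
proof -
  obtain R where R: "essential_in R (dom \<chi>)" "\<Phi> = \<chi> |` R" and h: "ri_hom \<chi>"
    using assms unfolding essential_extension_def by blast
  then have "dom \<Phi> = R" unfolding essential_in_def by auto
  then show "ri_hom \<chi>" "right_ideal (dom \<Phi>)" using R h unfolding essential_in_def by auto
  show "\<exists>z. w @ z \<in> dom \<Phi>" if "w \<in> dom \<chi>"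
    using that essential_extensionD[OF assms] by blast
qed

lemma essential_extension_trans:
  assumes "essential_extension \<Phi> \<chi>" "essential_extension \<chi> \<psi>"
  shows "essential_extension \<Phi> \<psi>"
proof (rule essential_extensionI)
  show "ri_hom \<psi>" "right_ideal (dom \<Phi>)" using assms essential_extension_dom by blast+
  show "\<Phi> \<subseteq>\<^sub>m \<psi>" using assms essential_extension_map_le map_le_trans by blast
  show "\<exists>z. w @ z \<in> dom \<Phi>" if "w \<in> dom \<psi>" for w
    using that essential_extension_dom(3)[OF assms(2)] essential_extension_dom(3)[OF assms(1)]
    by (metis append.assoc)
qed

lemma max_ext_maximal: "ri_hom \<Phi> \<Longrightarrow> maximal_essential_extension \<Phi> (max_ext \<Phi>)"
  unfolding max_ext_def by (rule theI'[OF maximal_essential_extension_ex1])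

lemma max_ext_essential: "ri_hom \<Phi> \<Longrightarrow> essential_extension \<Phi> (max_ext \<Phi>)"
  using max_ext_maximal unfolding maximal_essential_extension_def by blast

lemma max_ext_SomeI: "ri_hom \<Phi> \<Longrightarrow> \<Phi> w = Some v \<Longrightarrow> max_ext \<Phi> w = Some v"
  using essential_extension_map_le[OF max_ext_essential] unfolding map_le_def by (metis domI)

text \<open>An intrinsic description of the monoid elements that mentions no map of which
  \<open>\<chi>\<close> is the maximum extension.\<close>

definition saturated :: "('a list \<rightharpoonup> 'a list) \<Rightarrow> bool" where
  "saturated \<chi> \<longleftrightarrow> ri_hom \<chi> \<and> (\<forall>\<psi>. essential_extension \<chi> \<psi> \<longrightarrow> \<psi> = \<chi>)"

lemma saturated_max_ext:
  assumes "ri_hom \<Phi>" shows "saturated (max_ext \<Phi>)"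
  unfolding saturated_def
proof (intro conjI allI impI)
  show "ri_hom (max_ext \<Phi>)"
    using max_ext_essential[OF assms] essential_extension_dom by blast
  fix \<psi> assume "essential_extension (max_ext \<Phi>) \<psi>"
  then show "\<psi> = max_ext \<Phi>"
    using max_ext_maximal[OF assms] essential_extension_trans essential_extension_map_le
    unfolding maximal_essential_extension_def by blast
qed

lemma ri_homI:
  assumes "\<And>r s z. \<phi> r = Some s \<Longrightarrow> \<phi> (r @ z) = Some (s @ z)"
  shows "ri_hom \<phi>"
  using assms unfolding ri_hom_def right_ideal_def by fastforce

lemma saturated_Some: "saturated Some"
  unfolding saturated_def
proof (intro conjI allI impI)
  show "ri_hom Some" unfolding ri_hom_def right_ideal_def by auto
  fix \<psi> :: "'a list \<rightharpoonup> 'a list" assume "essential_extension Some \<psi>"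
  then have "Some \<subseteq>\<^sub>m \<psi>" by (rule essential_extension_map_le)
  then show "\<psi> = Some" by (auto simp: map_le_def)
qed

text \<open>Both maps are maximal essential extensions of their common restriction to words of
  length at least \<open>N\<close>, which is essential because every word can be padded. Such an
  extension is unique.\<close>

lemma saturated_eqI:
  assumes "saturated \<chi>" "saturated \<psi>" "\<And>w. N \<le> length w \<Longrightarrow> \<chi> w = \<psi> w"
  shows "\<chi> = \<psi>"
proof -
  let ?L = "{w. N \<le> length w}"
  have eq: "\<chi> |` ?L = \<psi> |` ?L" using assms(3) by (auto simp: restrict_map_def)
  have m: "maximal_essential_extension (\<xi> |` ?L) \<xi>" if s: "saturated \<xi>" for \<xi> :: "'a list \<rightharpoonup> 'a list"
    unfolding maximal_essential_extension_def
  proof (intro conjI allI impI)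
    have h: "ri_hom \<xi>" using s unfolding saturated_def by blast
    have d: "\<exists>z. w @ z \<in> dom (\<xi> |` ?L)" if w: "w \<in> dom \<xi>" for w
    proof -
      obtain v where "\<xi> w = Some v" using w by blast
      then have "w @ replicate N undefined \<in> dom (\<xi> |` ?L)" using ri_hom_append[OF h] by auto
      then show ?thesis by blast
    qed
    have r: "right_ideal (dom (\<xi> |` ?L))"
      using h unfolding ri_hom_def right_ideal_def by (auto simp: dom_restrict)
    show e: "essential_extension (\<xi> |` ?L) \<xi>"
      by (rule essential_extensionI[OF h r _ d]) (auto simp: map_le_def)
    fix \<psi> assume p: "essential_extension (\<xi> |` ?L) \<psi>" "\<xi> \<subseteq>\<^sub>m \<psi>"
    have "essential_extension \<xi> \<psi>"
    proof (rule essential_extensionI[OF _ _ p(2)])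
      show "ri_hom \<psi>" "right_ideal (dom \<xi>)" using p(1) essential_extension_dom h
        unfolding ri_hom_def by blast+
      show "\<exists>z. w @ z \<in> dom \<xi>" if "w \<in> dom \<psi>" for w
        using essential_extension_dom(3)[OF p(1) that] by auto
    qed
    then show "\<psi> = \<xi>" using s unfolding saturated_def by blast
  qed
  have "ri_hom (\<chi> |` ?L)"
    using assms(1) ri_hom_append unfolding saturated_def
    by (intro ri_homI) (auto simp: restrict_map_def split: if_splits)
  then show ?thesis
    using maximal_essential_extension_ex1 m[OF assms(1)] m[OF assms(2)] eq by auto
qed

lemma ri_hom_comp:
  assumes "ri_hom \<phi>" "ri_hom \<psi>" shows "ri_hom (\<phi> \<circ>\<^sub>m \<psi>)"
proof -
  have "(\<phi> \<circ>\<^sub>m \<psi>) (r @ z) = Some (s @ z)" if rs: "(\<phi> \<circ>\<^sub>m \<psi>) r = Some s" for r s z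
  proof -
    obtain t where t: "\<psi> r = Some t" "\<phi> t = Some s" using rs by (auto simp: map_comp_Some_iff)
    then show ?thesis using ri_hom_append[OF assms(2) t(1)] ri_hom_append[OF assms(1) t(2)] by simp
  qed
  then show ?thesis by (rule ri_homI)
qed

section \<open>Eventual values: agreement with a total function on all long words\<close>

definition ev_rep :: "('a list \<rightharpoonup> 'a list) \<Rightarrow> ('a list \<Rightarrow> 'a list) \<Rightarrow> bool" where
  "ev_rep g F \<longleftrightarrow> (\<exists>N. \<forall>w. N \<le> length w \<longrightarrow> g w = Some (F w))"

text \<open>The letters behind the first \<open>N\<close> are copied unchanged into the
  image.\<close>

lemma ri_hom_length_lower:
  assumes "ri_hom h" "h (take N w) \<noteq> None"
  shows "length w - N \<le> length (the (h w))"
proof -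
  obtain v where "h (take N w) = Some v" using assms(2) by blast
  then have "h w = Some (v @ drop N w)"
    using ri_hom_append[OF assms(1), of "take N w" v "drop N w"] by simp
  then show ?thesis by simp
qed

text \<open>A homomorphism defined on all long words shrinks them by at most a constant, so images
  of long words are long. This is what lets eventual values be composed.\<close>

lemma ev_rep_growth:
  assumes "ri_hom h" "ev_rep h G"
  shows "\<exists>N'. \<forall>w. N' \<le> length w \<longrightarrow> h w = Some (G w) \<and> N \<le> length (G w)"
proof -
  obtain M where M: "\<And>w. M \<le> length w \<Longrightarrow> h w = Some (G w)" using assms(2) unfolding ev_rep_def by blast
  have "h w = Some (G w) \<and> N \<le> length (G w)" if "M + N \<le> length w" for w
  proof -
    have "length w - M \<le> length (the (h w))"
      by (rule ri_hom_length_lower[OF assms(1)]) (use M that in auto)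
    then show ?thesis using M[of w] that by auto
  qed
  then show ?thesis by blast
qed

lemma ev_rep_cong:
  assumes "ev_rep g F" "ev_rep g F'"
  shows "\<exists>N. \<forall>w. N \<le> length w \<longrightarrow> F w = F' w"
proof -
  obtain N where "\<And>w. N \<le> length w \<Longrightarrow> g w = Some (F w)" using assms(1) unfolding ev_rep_def by blast
  moreover obtain N' where "\<And>w. N' \<le> length w \<Longrightarrow> g w = Some (F' w)" using assms(2) unfolding ev_rep_def by blast
  ultimately have "\<forall>w. max N N' \<le> length w \<longrightarrow> F w = F' w" by (metis max.bounded_iff option.inject)
  then show ?thesis by blast
qed

lemma ev_rep_max_ext: "ri_hom g \<Longrightarrow> ev_rep g F \<Longrightarrow> ev_rep (max_ext g) F"
  unfolding ev_rep_def using max_ext_SomeI by blast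

lemma ev_rep_comp:
  assumes "ri_hom h" "ev_rep g F" "ev_rep h G"
  shows "ev_rep (g \<circ>\<^sub>m h) (F \<circ> G)"
proof -
  obtain N where N: "\<And>w. N \<le> length w \<Longrightarrow> g w = Some (F w)" using assms(2) unfolding ev_rep_def by blast
  obtain N' where N': "\<And>w. N' \<le> length w \<Longrightarrow> h w = Some (G w) \<and> N \<le> length (G w)"
    using ev_rep_growth[OF assms(1,3)] by blast
  have "\<forall>w. N' \<le> length w \<longrightarrow> (g \<circ>\<^sub>m h) w = Some ((F \<circ> G) w)" using N N' by auto
  then show ?thesis unfolding ev_rep_def by blast
qed

lemma word_value_M_k1 [simp]:
  "word_value M_k1 [] = Some"
  "word_value M_k1 (g # ws) = max_ext (g \<circ>\<^sub>m word_value M_k1 ws)"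
  by (simp_all add: word_value_def M_k1_def)

lemma word_value_lepM_k1: "word_value lepM_k1 ws = word_value M_k1 ws"
  by (simp add: word_value_def lepM_k1_def M_k1_def)

lemma carrier_M_k1_saturated: "g \<in> carrier M_k1 \<Longrightarrow> saturated g"
  unfolding M_k1_def fg_ri_hom_def by (auto intro: saturated_max_ext)

lemma saturated_word_value:
  "set ws \<subseteq> carrier M_k1 \<Longrightarrow> saturated (word_value M_k1 ws)"
proof (induction ws)
  case (Cons g ws)
  then have "ri_hom g" "ri_hom (word_value M_k1 ws)"
    using carrier_M_k1_saturated unfolding saturated_def by auto
  then show ?case by (simp add: saturated_max_ext ri_hom_comp)
qed (simp add: saturated_Some)

text \<open>Nested products are compared only through their eventual values, which compose as plain
  functions.\<close>

lemma ev_rep_word_value_append: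
  assumes "set us \<subseteq> carrier M_k1" "\<And>g. g \<in> set us \<Longrightarrow> \<exists>H. ev_rep g H" "set vs \<subseteq> carrier M_k1"
    "ev_rep (word_value M_k1 us) F" "ev_rep (word_value M_k1 vs) G"
  shows "ev_rep (word_value M_k1 (us @ vs)) (F \<circ> G)"
proof -
  have hom: "ri_hom (word_value M_k1 ws)" if "set ws \<subseteq> carrier M_k1" for ws :: "('a list \<rightharpoonup> 'a list) list"
    using saturated_word_value[OF that] unfolding saturated_def by blast
  \<comment> \<open>\<open>F\<close> is prescribed only on long words and does not split along
    \<open>us\<close>, so the induction builds its own \<open>H\<close>. The two agree on long
    words, and values of \<open>G\<close> are eventually long.\<close>
  have ex: "\<exists>H. ev_rep (word_value M_k1 us) H \<and> ev_rep (word_value M_k1 (us @ vs)) (H \<circ> G)"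
    using assms(1,2)
  proof (induction us)
    case Nil
    have "ev_rep Some id" unfolding ev_rep_def by auto
    then show ?case using assms(5) by (metis append_Nil id_comp word_value_M_k1(1))
  next
    case (Cons g us)
    have "\<exists>H. ev_rep (word_value M_k1 us) H \<and> ev_rep (word_value M_k1 (us @ vs)) (H \<circ> G)"
      by (rule Cons.IH) (use Cons.prems in auto)
    then obtain H where H: "ev_rep (word_value M_k1 us) H" "ev_rep (word_value M_k1 (us @ vs)) (H \<circ> G)"
      by blast
    obtain E where E: "ev_rep g E" using Cons.prems(2) by auto
    have g: "ri_hom g" using Cons.prems(1) carrier_M_k1_saturated unfolding saturated_def by auto
    have h: "ri_hom (word_value M_k1 us)" "ri_hom (word_value M_k1 (us @ vs))"
      using hom Cons.prems(1) assms(3) by auto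
    have "ev_rep (word_value M_k1 (g # us)) (E \<circ> H)"
      using ev_rep_max_ext[OF ri_hom_comp[OF g h(1)] ev_rep_comp[OF h(1) E H(1)]] by simp
    moreover have "ev_rep (word_value M_k1 ((g # us) @ vs)) ((E \<circ> H) \<circ> G)"
      using ev_rep_max_ext[OF ri_hom_comp[OF g h(2)] ev_rep_comp[OF h(2) E H(2)]] by (simp add: comp_assoc)
    ultimately show ?case by blast
  qed
  then obtain H where H: "ev_rep (word_value M_k1 us) H" "ev_rep (word_value M_k1 (us @ vs)) (H \<circ> G)" by blast
  obtain N where N: "\<And>w. N \<le> length w \<Longrightarrow> H w = F w" using ev_rep_cong[OF H(1) assms(4)] by blast
  obtain N' where N': "\<And>w. N' \<le> length w \<Longrightarrow> N \<le> length (G w)"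
    using ev_rep_growth[OF hom[OF assms(3)] assms(5)] by blast
  obtain N'' where N'': "\<And>w. N'' \<le> length w \<Longrightarrow> word_value M_k1 (us @ vs) w = Some ((H \<circ> G) w)"
    using H(2) unfolding ev_rep_def by blast
  have "\<forall>w. max N' N'' \<le> length w \<longrightarrow> word_value M_k1 (us @ vs) w = Some ((F \<circ> G) w)"
    using N N' N'' by auto
  then show ?thesis unfolding ev_rep_def by blast
qed

section \<open>Maps of bounded prefixes and the length-equality preserving monoid\<close>

definition prefix_map :: "nat \<Rightarrow> ('a list \<Rightarrow> 'a list) \<Rightarrow> 'a list \<Rightarrow> 'a list" where
  "prefix_map m f w = f (take m w) @ drop m w"

text \<open>A word at least as long as all elements of \<open>P\<close> and without a prefix in
  \<open>P\<close> is incomparable to all of \<open>P\<close>, so adding it would give a larger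
  prefix code.\<close>

lemma finite_maximal_prefix_code_dom:
  assumes "finite P" "maximal_prefix_code P"
  shows "\<exists>N. \<forall>w. N \<le> length w \<longrightarrow> w \<in> ideal_of P"
proof -
  define N where "N = Max (length ` P)"
  have le: "length p \<le> N" if "p \<in> P" for p using that assms(1) unfolding N_def by auto
  have "w \<in> ideal_of P" if w: "N \<le> length w" for w
  proof (rule ccontr)
    assume n: "w \<notin> ideal_of P"
    then have np: "\<not> prefix p w" if "p \<in> P" for p
      using that unfolding ideal_of_def prefix_def by blast
    have np': "\<not> prefix w p" if "p \<in> P" for p
    proof
      assume "prefix w p"
      then obtain z where z: "p = w @ z" unfolding prefix_def by blast
      then have "z = []" using le[OF that] w by (cases z) auto
      then show False using np[OF that] z by simp
    qed
    have "prefix_code (insert w P)"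
      using assms(2) np np' unfolding maximal_prefix_code_def prefix_code_def by auto
    moreover have "w \<notin> P" using np by blast
    ultimately show False using assms(2) unfolding maximal_prefix_code_def by blast
  qed
  then show ?thesis by blast
qed

lemma length_equal_maximal_prefix_code:
  "maximal_prefix_code {u :: 'a list. length u = m}"
  unfolding maximal_prefix_code_def
proof (intro conjI allI impI)
  show "prefix_code {u :: 'a list. length u = m}"
    unfolding prefix_code_def by (auto simp: prefix_def)
  fix P' :: "'a list set" assume P': "prefix_code P'"
  show "\<not> {u. length u = m} \<subset> P'"
  proof
    assume s: "{u. length u = m} \<subset> P'"
    then obtain p where p: "p \<in> P'" "length p \<noteq> m" by auto
    \<comment> \<open>\<open>p\<close> cut or padded to length \<open>m\<close>: a word of the
      uniform code that is comparable to \<open>p\<close>.\<close>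
    let ?q = "take m p @ replicate (m - length p) undefined"
    have q: "length ?q = m" by auto
    then have "?q \<in> P'" using s by blast
    moreover have "prefix p ?q \<or> prefix ?q p"
      by (cases "length p \<le> m") (auto simp: take_is_prefix)
    ultimately have "p = ?q" using P' p(1) unfolding prefix_code_def by metis
    then show False using p(2) q by metis
  qed
qed

text \<open>The words of length \<open>m\<close> form a maximal prefix code, and images of one
  common length \<open>l\<close> again form a prefix code. All gates, and the insertion and deletion
  of a letter, enter the submonoid in this way.\<close>

lemma prefix_map_in_lepM_k1:
  fixes f :: "'a::finite list \<Rightarrow> 'a list"
  assumes f: "\<And>u. length u = m \<Longrightarrow> length (f u) = l"
  shows "\<exists>g\<in>carrier lepM_k1. ev_rep g (prefix_map m f)"
proof -
  define \<phi> where "\<phi> w = (if m \<le> length w then Some (prefix_map m f w) else None)" for w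
  let ?P = "{u :: 'a list. length u = m}"
  have finP: "finite ?P" using finite_lists_length_eq[of "UNIV :: 'a set" m] by simp
  have app: "\<phi> (r @ z) = Some (the (\<phi> r) @ z)" if "m \<le> length r" for r z
    using that by (simp add: \<phi>_def prefix_map_def)
  have domL: "dom \<phi> = {w. m \<le> length w}" unfolding \<phi>_def by (auto simp: domIff split: if_splits)
  have hom: "ri_hom \<phi>"
    unfolding ri_hom_def right_ideal_def using app by (auto simp: domL)
  have d: "dom \<phi> = ideal_of ?P"
  proof -
    have "w \<in> ideal_of ?P" if "m \<le> length w" for w :: "'a list"
      unfolding ideal_of_def using that
      by (intro CollectI exI[of _ "take m w"] exI[of _ "drop m w"]) auto
    then show ?thesis unfolding domL ideal_of_def by auto
  qed
  have r: "ran \<phi> = ideal_of (f ` ?P)"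
  proof (intro equalityI subsetI)
    fix y assume "y \<in> ran \<phi>"
    then obtain w where w: "\<phi> w = Some y" unfolding ran_def by blast
    then have "y = f (take m w) @ drop m w" "take m w \<in> ?P"
      unfolding \<phi>_def prefix_map_def by (auto split: if_splits)
    then show "y \<in> ideal_of (f ` ?P)" unfolding ideal_of_def by blast
  next
    fix y assume "y \<in> ideal_of (f ` ?P)"
    then obtain u z where "length u = m" "y = f u @ z" unfolding ideal_of_def by auto
    then have "\<phi> (u @ z) = Some y" unfolding \<phi>_def prefix_map_def by auto
    then show "y \<in> ran \<phi>" unfolding ran_def by blast
  qed
  have Q: "prefix_code (f ` ?P)"
    using length_equal_maximal_prefix_code[of l] f
    unfolding maximal_prefix_code_def prefix_code_def by auto
  have lep: "length_equality_preserving \<phi>"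
    unfolding length_equality_preserving_def domL by (auto simp: \<phi>_def prefix_map_def f)
  have "fg_ri_hom \<phi>" unfolding fg_ri_hom_def fg_right_ideal_def using hom d r finP by blast
  then have "max_ext \<phi> \<in> carrier M_k1" unfolding M_k1_def by auto
  moreover have "\<exists>\<psi> P Q. finite P \<and> maximal_prefix_code P \<and> finite Q \<and> prefix_code Q \<and>
     ri_hom \<psi> \<and> dom \<psi> = ideal_of P \<and> ran \<psi> = ideal_of Q \<and>
     length_equality_preserving \<psi> \<and> max_ext \<phi> = max_ext \<psi>"
    by (rule exI[of _ \<phi>], rule exI[of _ ?P], rule exI[of _ "f ` ?P"])
      (use finP length_equal_maximal_prefix_code Q hom d r lep in simp)
  ultimately have "max_ext \<phi> \<in> carrier lepM_k1" unfolding lepM_k1_def by simp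
  moreover have "ev_rep (max_ext \<phi>) (prefix_map m f)"
    by (rule ev_rep_max_ext[OF hom]) (auto simp: ev_rep_def \<phi>_def)
  ultimately show ?thesis by blast
qed

lemma lepM_k1_elem:
  assumes "x \<in> carrier lepM_k1"
  shows "x \<in> carrier M_k1"
    and "\<exists>F N d. \<forall>w. N \<le> length w \<longrightarrow> x w = Some (F w) \<and> int (length (F w)) = int (length w) + d"
proof -
  show "x \<in> carrier M_k1" using assms unfolding lepM_k1_def by auto
  obtain \<phi> P where P: "finite P" "maximal_prefix_code P" "ri_hom \<phi>" "dom \<phi> = ideal_of P"
    "length_equality_preserving \<phi>" "x = max_ext \<phi>"
    using assms unfolding lepM_k1_def by auto
  obtain N where N: "\<And>w. N \<le> length w \<Longrightarrow> w \<in> dom \<phi>"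
    using finite_maximal_prefix_code_dom[OF P(1,2)] P(4) by auto
  \<comment> \<open>One reference word of length \<open>N\<close>: every prefix of \<open>N\<close>
    letters has an image as long as that of \<open>u\<close>, and the remaining letters are copied.
    The change \<open>d\<close> may be negative, hence an integer.\<close>
  define u where "u = replicate N (undefined :: 'a)"
  define d where "d = int (length (the (\<phi> u))) - int N"
  have "x w = Some (the (\<phi> w)) \<and> int (length (the (\<phi> w))) = int (length w) + d" if w: "N \<le> length w" for w
  proof
    obtain v where v: "\<phi> w = Some v" using N[OF w] by blast
    then show "x w = Some (the (\<phi> w))" using max_ext_SomeI[OF P(3) v] P(6) by simp
    define t where "t = take N w"
    have t: "t \<in> dom \<phi>" "u \<in> dom \<phi>" "length t = length u" using N w unfolding u_def t_def by auto
    then have l: "length (the (\<phi> t)) = length (the (\<phi> u))"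
      using P(5) unfolding length_equality_preserving_def by blast
    have "\<phi> (t @ drop N w) = Some (the (\<phi> t) @ drop N w)"
      using ri_hom_append[OF P(3)] t(1) by fastforce
    then show "int (length (the (\<phi> w))) = int (length w) + d"
      using l w unfolding t_def d_def by simp
  qed
  then show "\<exists>F N d. \<forall>w. N \<le> length w \<longrightarrow> x w = Some (F w) \<and> int (length (F w)) = int (length w) + d"
    by (intro exI[of _ "\<lambda>w. the (\<phi> w)"] exI[of _ N] exI[of _ d]) blast
qed

section \<open>Generators, costs and gates\<close>

text \<open>One extension brings the word into the domain of \<open>\<psi>\<close>, a further one
  brings its image into the domain of \<open>\<phi>\<close>.\<close>

lemma essential_extension_comp:
  assumes "essential_extension \<phi> g" "essential_extension \<psi> h" "ri_hom \<phi>" "ri_hom \<psi>"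
  shows "essential_extension (\<phi> \<circ>\<^sub>m \<psi>) (g \<circ>\<^sub>m h)"
proof (rule essential_extensionI)
  have g: "ri_hom g" and h: "ri_hom h" using assms essential_extension_dom by blast+
  show "ri_hom (g \<circ>\<^sub>m h)" using g h by (rule ri_hom_comp)
  show "right_ideal (dom (\<phi> \<circ>\<^sub>m \<psi>))" using ri_hom_comp[OF assms(3,4)] unfolding ri_hom_def by blast
  have le: "g w = Some v" if "\<phi> w = Some v" for w v
    using essential_extension_map_le[OF assms(1)] that unfolding map_le_def by (metis domI)
  have le': "h w = Some v" if "\<psi> w = Some v" for w v
    using essential_extension_map_le[OF assms(2)] that unfolding map_le_def by (metis domI)
  show "\<phi> \<circ>\<^sub>m \<psi> \<subseteq>\<^sub>m g \<circ>\<^sub>m h"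
    unfolding map_le_def
  proof
    fix w assume "w \<in> dom (\<phi> \<circ>\<^sub>m \<psi>)"
    then obtain t v where "\<psi> w = Some t" "\<phi> t = Some v" by (auto simp: map_comp_Some_iff)
    then show "(\<phi> \<circ>\<^sub>m \<psi>) w = (g \<circ>\<^sub>m h) w" using le le' by simp
  qed
  fix w assume "w \<in> dom (g \<circ>\<^sub>m h)"
  then obtain t v where t: "h w = Some t" "g t = Some v" by (auto simp: map_comp_Some_iff)
  obtain z where z: "\<psi> (w @ z) = Some (t @ z)" using essential_extensionD[OF assms(2) t(1)] by blast
  have "g (t @ z) = Some (v @ z)" using ri_hom_append[OF g t(2)] .
  then obtain z' s where z': "\<phi> ((t @ z) @ z') = Some s"
    using essential_extensionD[OF assms(1)] by blast
  then have "(\<phi> \<circ>\<^sub>m \<psi>) (w @ z @ z') = Some s" using ri_hom_append[OF assms(4) z, of z'] by simp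
  then show "\<exists>z. w @ z \<in> dom (\<phi> \<circ>\<^sub>m \<psi>)" by blast
qed

text \<open>Over a finite alphabet this holds for some \<open>N\<close> iff the domain, a right ideal, is finitely generated.\<close>

definition decided_by :: "nat \<Rightarrow> ('a list \<rightharpoonup> 'a list) \<Rightarrow> bool" where
  "decided_by N \<phi> \<longleftrightarrow> (\<forall>w z. N \<le> length w \<longrightarrow> w @ z \<in> dom \<phi> \<longrightarrow> w \<in> dom \<phi>)"

text \<open>The first \<open>N\<close> letters of the input already lie in the domain of
  \<open>\<psi>\<close>, so the other \<open>M\<close> are copied and at least \<open>M\<close>
  letters reach \<open>\<phi>\<close>, enough for it to decide.\<close>

lemma decided_by_comp:
  assumes "decided_by M \<phi>" "decided_by N \<psi>" "ri_hom \<psi>"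
  shows "decided_by (N + M) (\<phi> \<circ>\<^sub>m \<psi>)"
  unfolding decided_by_def
proof (intro allI impI)
  fix w z assume w: "N + M \<le> length w" "w @ z \<in> dom (\<phi> \<circ>\<^sub>m \<psi>)"
  then obtain t v where t: "\<psi> (w @ z) = Some t" "\<phi> t = Some v" by (auto simp: map_comp_Some_iff)
  have "take N w \<in> dom \<psi>"
    using assms(2) t(1) w(1) unfolding decided_by_def
    by (metis add_leD1 append.assoc append_take_drop_id domI length_take min.absorb2 order_refl)
  moreover have "w \<in> dom \<psi>"
    using assms(2) t(1) w(1) unfolding decided_by_def by (meson add_leD1 domI)
  then obtain s where s: "\<psi> w = Some s" by blast
  ultimately have "length w - N \<le> length s"
    using ri_hom_length_lower[OF assms(3), of N w] by auto
  moreover have "t = s @ z" using ri_hom_append[OF assms(3) s, of z] t(1) by simp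
  ultimately have "s \<in> dom \<phi>"
    using assms(1) t(2) w(1) unfolding decided_by_def by (metis add_le_imp_le_diff add.commute domI order.trans)
  then show "w \<in> dom (\<phi> \<circ>\<^sub>m \<psi>)" using s by (simp add: domIff)
qed

lemma decided_by_ideal_of:
  assumes "dom \<phi> = ideal_of P" "\<And>p. p \<in> P \<Longrightarrow> length p \<le> N"
  shows "decided_by N \<phi>"
  unfolding decided_by_def
proof (intro allI impI)
  fix w z assume w: "N \<le> length w" "w @ z \<in> dom \<phi>"
  then obtain p y where p: "p \<in> P" "w @ z = p @ y" using assms(1) unfolding ideal_of_def by auto
  then have "prefix p w" using assms(2)[OF p(1)] w(1)
    by (metis order.trans prefix_length_prefix prefixI)
  then show "w \<in> dom \<phi>" using p(1) assms(1) unfolding ideal_of_def prefix_def by auto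
qed

text \<open>\<open>decided_by\<close> expresses finite generation of the domain in a form that
  passes directly to compositions.\<close>

definition fg_rep :: "('a list \<rightharpoonup> 'a list) \<Rightarrow> ('a list \<rightharpoonup> 'a list) \<Rightarrow> bool" where
  "fg_rep \<phi> g \<longleftrightarrow> essential_extension \<phi> g \<and> ri_hom \<phi> \<and> (\<exists>N. decided_by N \<phi>)"

definition run :: "(('a list \<rightharpoonup> 'a list) \<Rightarrow> ('a list \<rightharpoonup> 'a list)) \<Rightarrow> ('a list \<rightharpoonup> 'a list) list \<Rightarrow> ('a list \<rightharpoonup> 'a list)" where
  "run \<rho> ws = foldr (\<lambda>g h. \<rho> g \<circ>\<^sub>m h) ws Some"

lemma run_simps [simp]: "run \<rho> [] = Some" "run \<rho> (g # ws) = \<rho> g \<circ>\<^sub>m run \<rho> ws"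
  by (simp_all add: run_def)

text \<open>Each maximization in the value of the word is just a further essential
  extension.\<close>

lemma fg_rep_run:
  assumes "\<And>g. g \<in> set ws \<Longrightarrow> fg_rep (\<rho> g) g"
  shows "fg_rep (run \<rho> ws) (word_value M_k1 ws)"
  using assms
proof (induction ws)
  case Nil
  have "essential_extension Some Some"
    using saturated_Some unfolding saturated_def
    by (intro essential_extensionI) (auto simp: right_ideal_def)
  then show ?case using saturated_Some unfolding fg_rep_def saturated_def
    by (auto simp: decided_by_def)
next
  case (Cons g ws)
  then have g: "fg_rep (\<rho> g) g" and ws: "fg_rep (run \<rho> ws) (word_value M_k1 ws)" by auto
  then have e: "essential_extension (\<rho> g \<circ>\<^sub>m run \<rho> ws) (g \<circ>\<^sub>m word_value M_k1 ws)"
    unfolding fg_rep_def by (intro essential_extension_comp) auto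
  have "essential_extension (\<rho> g \<circ>\<^sub>m run \<rho> ws) (max_ext (g \<circ>\<^sub>m word_value M_k1 ws))"
    using e essential_extension_trans max_ext_essential essential_extension_dom(1)[OF e] by blast
  moreover have "ri_hom (\<rho> g \<circ>\<^sub>m run \<rho> ws)" using g ws unfolding fg_rep_def by (intro ri_hom_comp) auto
  moreover have "\<exists>N. decided_by N (\<rho> g \<circ>\<^sub>m run \<rho> ws)"
    using g ws decided_by_comp unfolding fg_rep_def by metis
  ultimately show ?case unfolding fg_rep_def by simp
qed

text \<open>Essentiality extends a long word w into the domain of \<open>\<phi>\<close>, and
  \<open>decided_by\<close> pulls this back to w itself. So the representative already computes the
  values of \<open>g\<close> on long words.\<close>

lemma fg_rep_ev_rep:
  assumes "fg_rep \<phi> g" "ev_rep g F"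
  shows "ev_rep \<phi> F"
proof -
  obtain N where N: "decided_by N \<phi>" using assms(1) unfolding fg_rep_def by blast
  obtain M where M: "\<And>w. M \<le> length w \<Longrightarrow> g w = Some (F w)" using assms(2) unfolding ev_rep_def by blast
  have e: "essential_extension \<phi> g" using assms(1) unfolding fg_rep_def by blast
  have "\<phi> w = Some (F w)" if w: "max M N \<le> length w" for w
  proof -
    have gw: "g w = Some (F w)" using M w by simp
    obtain z t where "\<phi> (w @ z) = Some t" using essential_extensionD[OF e gw] by blast
    then have "w \<in> dom \<phi>" using N w unfolding decided_by_def by (meson domI max.bounded_iff)
    then show ?thesis using essential_extension_map_le[OF e] gw unfolding map_le_def by metis
  qed
  then show ?thesis unfolding ev_rep_def by blast
qed

section \<open>Position transpositions and cost bounds over the generators\<close>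

definition swap_at :: "nat \<Rightarrow> nat \<Rightarrow> 'a list \<Rightarrow> 'a list" where
  "swap_at a b w = w[a := w ! b, b := w ! a]"

lemma length_swap_at [simp]: "length (swap_at a b w) = length w"
  by (simp add: swap_at_def)

lemma swap_at_append: "a < length w \<Longrightarrow> b < length w \<Longrightarrow> swap_at a b (w @ z) = swap_at a b w @ z"
  by (simp add: swap_at_def nth_append list_update_append)

lemma pos_transposition_swap_at:
  "pos_transposition i j w = (if j \<le> length w then Some (swap_at (i - 1) (j - 1) w) else None)"
  by (simp add: pos_transposition_def swap_at_def)

lemma fg_rep_pos_transposition:
  assumes "1 \<le> i" "i < j"
  shows "fg_rep (pos_transposition i j) (pos_transposition i j)"
  unfolding fg_rep_def
proof (intro conjI)
  show h: "ri_hom (pos_transposition i j)"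
    using assms by (intro ri_homI) (auto simp: pos_transposition_swap_at swap_at_append split: if_splits)
  show "essential_extension (pos_transposition i j) (pos_transposition i j)"
    using h by (intro essential_extensionI) (auto simp: ri_hom_def intro: exI[of _ "[]"])
  have "decided_by j (pos_transposition i j)"
    by (auto simp: decided_by_def pos_transposition_swap_at)
  then show "\<exists>N. decided_by N (pos_transposition i j)" by blast
qed

text \<open>Only values on long inputs are recorded, so costs of total functions simply add under
  composition.\<close>

definition cost_le :: "('a list \<rightharpoonup> 'a list) set \<Rightarrow> nat \<Rightarrow> ('a list \<Rightarrow> 'a list) \<Rightarrow> bool" where
  "cost_le S n F \<longleftrightarrow> (\<exists>ws\<in>lists S. length ws \<le> n \<and> ev_rep (word_value M_k1 ws) F)"

lemma cost_le_mono: "cost_le S m F \<Longrightarrow> m \<le> n \<Longrightarrow> cost_le S n F"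
  unfolding cost_le_def by (meson order.trans)

lemma cost_le_id: "cost_le S 0 id"
  unfolding cost_le_def by (rule bexI[of _ "[]"]) (auto simp: ev_rep_def)

context
  fixes S :: "('a::finite list \<rightharpoonup> 'a list) set"
  assumes gen: "generating_set lepM_k1 S"
begin

lemma gen_carrier: "g \<in> S \<Longrightarrow> g \<in> carrier M_k1 \<and> (\<exists>H. ev_rep g H)"
proof -
  assume "g \<in> S"
  then have g: "g \<in> carrier lepM_k1" using gen unfolding generating_set_def by auto
  obtain F N d where
    "\<forall>w. N \<le> length w \<longrightarrow> g w = Some (F w) \<and> int (length (F w)) = int (length w) + d"
    using lepM_k1_elem(2)[OF g] by blast
  then have "ev_rep g F" unfolding ev_rep_def by blast
  then show ?thesis using lepM_k1_elem(1)[OF g] by blast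
qed

lemma cost_le_comp:
  assumes "cost_le S m F" "cost_le S n G" shows "cost_le S (m + n) (F \<circ> G)"
proof -
  obtain us where us: "us \<in> lists S" "length us \<le> m" "ev_rep (word_value M_k1 us) F"
    using assms(1) unfolding cost_le_def by blast
  obtain vs where vs: "vs \<in> lists S" "length vs \<le> n" "ev_rep (word_value M_k1 vs) G"
    using assms(2) unfolding cost_le_def by blast
  have "ev_rep (word_value M_k1 (us @ vs)) (F \<circ> G)"
    by (rule ev_rep_word_value_append) (use us vs gen_carrier in auto)
  then show ?thesis unfolding cost_le_def using us vs by (intro bexI[of _ "us @ vs"]) auto
qed

lemma cost_le_fold:
  assumes "\<And>p. p \<in> set ps \<Longrightarrow> cost_le S C (G p)"
  shows "cost_le S (C * length ps) (fold G ps)"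
  using assms
proof (induction ps)
  case (Cons p ps)
  then have "cost_le S (C * length ps + C) (fold G ps \<circ> G p)"
    by (intro cost_le_comp[where F = "fold G ps"]) auto
  moreover have "fold G (p # ps) = fold G ps \<circ> G p" by (rule ext) simp
  moreover have "C * length (p # ps) = C * length ps + C" by simp
  ultimately show ?case by (simp only:)
qed (use cost_le_id in \<open>simp add: id_def\<close>)

lemma cost_le_funpow: "cost_le S C F \<Longrightarrow> cost_le S (C * n) (F ^^ n)"
proof (induction n)
  case (Suc n)
  then have "cost_le S (C + C * n) (F \<circ> F ^^ n)" by (intro cost_le_comp) auto
  then show ?case by (simp only: funpow.simps mult_Suc_right)
qed (use cost_le_id in \<open>simp add: id_def\<close>)

lemma cost_le_of_elem:
  assumes "g \<in> carrier lepM_k1" "ev_rep g F" shows "\<exists>n. cost_le S n F"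
proof -
  have "g \<in> word_value lepM_k1 ` lists S" using gen assms(1) unfolding generating_set_def by simp
  then obtain ws where ws: "g = word_value M_k1 ws" "ws \<in> lists S" unfolding word_value_lepM_k1 by blast
  have "cost_le S (length ws) F"
    unfolding cost_le_def by (rule bexI[OF _ ws(2)]) (use assms(2) ws(1) in auto)
  then show ?thesis ..
qed

text \<open>There is no estimate of \<open>n\<close> in terms of \<open>f\<close>; the final bound
  uses finitely many \<open>f\<close>, whose costs merge into a constant.\<close>

lemma cost_le_prefix_map:
  assumes "\<And>u. length u = m \<Longrightarrow> length (f u) = l"
  shows "\<exists>n. cost_le S n (prefix_map m f)"
  using cost_le_of_elem prefix_map_in_lepM_k1[of m f l] assms by blast

lemma cost_le_swap_at:
  assumes "pos_transpositions \<subseteq> S" "a < b"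
  shows "cost_le S 1 (swap_at a b)"
  unfolding cost_le_def
proof (intro bexI conjI)
  let ?t = "pos_transposition (Suc a) (Suc b) :: 'a list \<rightharpoonup> 'a list"
  have t: "ri_hom ?t" using fg_rep_pos_transposition[of "Suc a" "Suc b"] assms(2) unfolding fg_rep_def by auto
  have "ev_rep ?t (swap_at a b)"
    unfolding ev_rep_def by (rule exI[of _ "Suc b"]) (auto simp: pos_transposition_swap_at)
  moreover have "?t \<circ>\<^sub>m Some = ?t" by (auto simp: map_comp_def)
  ultimately show "ev_rep (word_value M_k1 [?t]) (swap_at a b)" using ev_rep_max_ext[OF t] by simp
  show "[?t] \<in> lists S" using assms unfolding pos_transpositions_def by fastforce
qed simp

text \<open>Values of words are saturated, so agreeing with x on long inputs already means being
  equal to x.\<close>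

lemma word_length_le_cost:
  assumes "x \<in> carrier lepM_k1" "ev_rep x F" "cost_le S n F"
  shows "word_length lepM_k1 S x \<le> n"
proof -
  obtain ws where ws: "ws \<in> lists S" "length ws \<le> n" "ev_rep (word_value M_k1 ws) F"
    using assms(3) unfolding cost_le_def by blast
  obtain N where N: "\<And>w. N \<le> length w \<Longrightarrow> x w = Some (F w)" using assms(2) unfolding ev_rep_def by blast
  obtain N' where N': "\<And>w. N' \<le> length w \<Longrightarrow> word_value M_k1 ws w = Some (F w)"
    using ws(3) unfolding ev_rep_def by blast
  have "word_value M_k1 ws = x"
  proof (rule saturated_eqI[where N = "max N N'"])
    show "saturated (word_value M_k1 ws)" by (rule saturated_word_value) (use ws(1) gen_carrier in auto)
    show "saturated x" using assms(1) lepM_k1_elem carrier_M_k1_saturated by blast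
  qed (use N N' in auto)
  then have "word_length lepM_k1 S x \<le> length ws"
    unfolding word_length_def using ws(1) by (intro Least_le) (auto simp: word_value_lepM_k1)
  then show ?thesis using ws(2) by simp
qed

end

text \<open>Conjugating by \<open>exchange\<close> makes a map of prefixes act on the cells \<open>0 # ts\<close>; the positions
  \<open>1, \<dots>, length ts\<close> serve as scratch space.\<close>

definition exchange :: "nat list \<Rightarrow> 'a list \<Rightarrow> 'a list" where
  "exchange ts = fold (\<lambda>i. swap_at (Suc i) (ts ! i)) [0..<length ts]"

definition gate :: "('a list \<Rightarrow> 'a list) \<Rightarrow> nat list \<Rightarrow> 'a list \<Rightarrow> 'a list" where
  "gate f ts = exchange ts \<circ> prefix_map (Suc (length ts)) f \<circ> exchange ts"

text \<open>All targets lie beyond \<open>length ts\<close>, so they are disjoint from the scratch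
  cells, the swaps act on disjoint pairs, and cell 0 never moves.\<close>

lemma exchange_nth:
  assumes "distinct ts" "\<forall>t\<in>set ts. length ts < t \<and> t < length w"
  shows "length (exchange ts w) = length w"
    and "i < length ts \<Longrightarrow> exchange ts w ! Suc i = w ! (ts ! i)"
    and "i < length ts \<Longrightarrow> exchange ts w ! (ts ! i) = w ! Suc i"
    and "k \<notin> Suc ` {..<length ts} \<Longrightarrow> k \<notin> set ts \<Longrightarrow> exchange ts w ! k = w ! k"
proof -
  define W where "W n = fold (\<lambda>i. swap_at (Suc i) (ts ! i)) [0..<n] w" for n
  have W: "W 0 = w" "W (Suc n) = swap_at (Suc n) (ts ! n) (W n)" for n unfolding W_def by auto
  have tn: "length ts < ts ! i" "ts ! i < length w" if "i < length ts" for i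
    using that assms(2) by auto
  have inv: "length (W n) = length w \<and> (\<forall>i<n. W n ! Suc i = w ! (ts ! i)) \<and>
      (\<forall>i<n. W n ! (ts ! i) = w ! Suc i) \<and>
      (\<forall>k. k \<notin> Suc ` {..<n} \<longrightarrow> (\<forall>i<n. k \<noteq> ts ! i) \<longrightarrow> W n ! k = w ! k)" if "n \<le> length ts" for n
    using that
  proof (induction n)
    case (Suc n)
    then have IH: "length (W n) = length w" "\<And>i. i < n \<Longrightarrow> W n ! Suc i = w ! (ts ! i)"
      "\<And>i. i < n \<Longrightarrow> W n ! (ts ! i) = w ! Suc i"
      "\<And>k. k \<notin> Suc ` {..<n} \<Longrightarrow> (\<And>i. i < n \<Longrightarrow> k \<noteq> ts ! i) \<Longrightarrow> W n ! k = w ! k" by auto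
    have n: "n < length ts" using Suc.prems by simp
    have d: "ts ! n \<noteq> ts ! i" if "i < n" for i
      using that n assms(1) by (simp add: nth_eq_iff_index_eq)
    have s: "ts ! i \<noteq> Suc j" if "i < length ts" "j < length ts" for i j using tn[OF that(1)] that(2) by simp
    have nt: "W n ! (ts ! n) = w ! (ts ! n)" by (rule IH(4)) (use d s n in auto)
    have ns: "W n ! Suc n = w ! Suc n" by (rule IH(4)) (use s[symmetric] n in auto)
    have lt: "Suc n < length w" "ts ! n < length w" using tn[OF n] n by auto
    show ?case
    proof (intro conjI allI impI)
      show "length (W (Suc n)) = length w" by (simp add: W IH)
      show "W (Suc n) ! Suc i = w ! (ts ! i)" if "i < Suc n" for i
        using that nt lt IH s[OF n, of i] n by (cases "i = n") (auto simp: W swap_at_def nth_list_update)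
      show "W (Suc n) ! (ts ! i) = w ! Suc i" if "i < Suc n" for i
        using that ns lt IH d s[of i n] n by (cases "i = n") (auto simp: W swap_at_def nth_list_update)
      show "W (Suc n) ! k = w ! k" if "k \<notin> Suc ` {..<Suc n}" "\<forall>i<Suc n. k \<noteq> ts ! i" for k
        using that IH(4)[of k] by (auto simp: W swap_at_def nth_list_update lessThan_Suc)
    qed
  qed (simp add: W)
  have e: "exchange ts w = W (length ts)" unfolding exchange_def W_def ..
  note inv' = inv[OF order_refl, folded e]
  show "length (exchange ts w) = length w" using inv' by blast
  show "i < length ts \<Longrightarrow> exchange ts w ! Suc i = w ! (ts ! i)" using inv' by blast
  show "i < length ts \<Longrightarrow> exchange ts w ! (ts ! i) = w ! Suc i" using inv' by blast
  show "k \<notin> Suc ` {..<length ts} \<Longrightarrow> k \<notin> set ts \<Longrightarrow> exchange ts w ! k = w ! k"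
    using inv' by (metis nth_mem)
qed

text \<open>The first exchange puts the targets behind cell 0, which keeps the flag;
  \<open>f\<close> rewrites this prefix; the second exchange carries the results back and restores
  the scratch cells.\<close>

lemma gate_nth:
  fixes w :: "'a list"
  assumes ts: "distinct ts" "\<forall>t\<in>set ts. length ts < t \<and> t < length w"
    and w: "length ts < length w"
    and v: "f (w ! 0 # map (nth w) ts) = v" "length v = Suc (length ts)"
  shows "length (gate f ts w) = length w"
    and "gate f ts w ! 0 = v ! 0"
    and "i < length ts \<Longrightarrow> gate f ts w ! (ts ! i) = v ! Suc i"
    and "0 < k \<Longrightarrow> k < length w \<Longrightarrow> k \<notin> set ts \<Longrightarrow> gate f ts w ! k = w ! k"
proof -
  let ?m = "length ts"
  let ?y = "exchange ts w"
  note y = exchange_nth[OF ts]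
  have z: "0 \<notin> set ts" using ts(2) by fastforce
  have y0: "?y ! 0 = w ! 0" by (rule y(4)) (use z in auto)
  have tk: "take (Suc ?m) ?y = w ! 0 # map (nth w) ts"
    using w y(1) y(2) y0 by (intro nth_equalityI) (auto simp: nth_Cons split: nat.splits)
  have p: "prefix_map (Suc ?m) f ?y = v @ drop (Suc ?m) ?y" unfolding prefix_map_def tk v(1) ..
  define x where "x = v @ drop (Suc ?m) ?y"
  have lx: "length x = length w" unfolding x_def using v(2) w y(1) by simp
  have xv: "x ! k = v ! k" if "k \<le> ?m" for k unfolding x_def using that v(2) by (simp add: nth_append)
  have xy: "x ! k = ?y ! k" if "?m < k" "k < length w" for k
    unfolding x_def using that v(2) w y(1) by (simp add: nth_append)
  have tsx: "\<forall>t\<in>set ts. length ts < t \<and> t < length x" using ts(2) lx by simp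
  note ex = exchange_nth[OF ts(1) tsx]
  have g: "gate f ts w = exchange ts x" unfolding gate_def x_def using p by simp
  show "length (gate f ts w) = length w" using g ex(1) lx by simp
  have "exchange ts x ! 0 = x ! 0" by (rule ex(4)) (use z in auto)
  then show "gate f ts w ! 0 = v ! 0" using g xv by simp
  show "gate f ts w ! (ts ! i) = v ! Suc i" if "i < ?m"
    using g ex(3)[OF that] xv[of "Suc i"] that by simp
  show "gate f ts w ! k = w ! k" if k: "0 < k" "k < length w" "k \<notin> set ts"
  proof (cases "k \<le> ?m")
    \<comment> \<open>A scratch letter waits at the target \<open>ts ! i\<close> between the two
      exchanges.\<close>
    case True
    then obtain i where i: "k = Suc i" "i < ?m" using k(1) by (cases k) auto
    then have "gate f ts w ! k = x ! (ts ! i)" using g ex(2) by simp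
    also have "\<dots> = ?y ! (ts ! i)" using xy i(2) ts(2) by simp
    also have "\<dots> = w ! k" using y(3) i by simp
    finally show ?thesis .
  next
    case False
    then have "exchange ts x ! k = x ! k" using k by (intro ex(4)) auto
    also have "\<dots> = ?y ! k" using xy False k by simp
    also have "\<dots> = w ! k" using False k by (intro y(4)) auto
    finally show ?thesis using g by simp
  qed
qed

lemma gate_idle:
  assumes "distinct ts" "\<forall>t\<in>set ts. length ts < t \<and> t < length w" "length ts < length w"
    and "f (w ! 0 # map (nth w) ts) = w ! 0 # map (nth w) ts"
  shows "gate f ts w = w"
proof (rule nth_equalityI)
  have l: "length (w ! 0 # map (nth w) ts) = Suc (length ts)" by simp
  note g = gate_nth[where f = f and w = w, OF assms l]
  show "length (gate f ts w) = length w" using g(1) .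
  show "gate f ts w ! k = w ! k" if "k < length (gate f ts w)" for k
  proof (cases "k \<in> set ts")
    case True
    then obtain i where "i < length ts" "k = ts ! i" by (metis in_set_conv_nth)
    then show ?thesis using g(3)[of i] by simp
  next
    case False
    then show ?thesis using g(1,2) g(4)[of k] that by (cases "k = 0") auto
  qed
qed

text \<open>Here the targets are consecutive cells, and \<open>s\<close> is long enough to contain
  all the scratch cells.\<close>

lemma gate_window:
  assumes "f (a # v) = b # v'" "length v = m" "length v' = m" "m \<le> length s"
  shows "gate f [Suc (length s)..<Suc (length s) + m] (a # s @ v @ r) = b # s @ v' @ r"
proof -
  let ?q = "Suc (length s)" let ?w = "a # s @ v @ r"
  let ?ts = "[?q..<?q + m]"
  have lt: "length ?ts = m" by simp
  have mp: "map (nth ?w) ?ts = v"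
    using assms(2) by (intro nth_equalityI) (auto simp: nth_append simp del: upt_Suc)
  have 1: "distinct ?ts" "\<forall>t\<in>set ?ts. length ?ts < t \<and> t < length ?w" "length ?ts < length ?w"
    using assms by (auto simp del: upt_Suc)
  have 2: "f (?w ! 0 # map (nth ?w) ?ts) = b # v'" unfolding mp using assms(1) by simp
  have 3: "length (b # v') = Suc (length ?ts)" using assms(3) by simp
  note g = gate_nth[where f = f and w = ?w, OF 1 2 3]
  show ?thesis
  proof (rule nth_equalityI)
    show "length (gate f ?ts ?w) = length (b # s @ v' @ r)" using g(1) assms by simp
    fix k assume "k < length (gate f ?ts ?w)"
    then have k: "k < length ?w" using g(1) by simp
    show "gate f ?ts ?w ! k = (b # s @ v' @ r) ! k"
    proof (cases "k \<in> set ?ts")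
      case True
      then obtain i where i: "k = ?q + i" "i < m" by (auto simp: le_iff_add simp del: upt_Suc)
      then have "gate f ?ts ?w ! k = v' ! i" using g(3)[of i] lt by (simp add: nth_upt del: upt_Suc)
      then show ?thesis using i assms by (simp add: nth_append)
    next
      case False
      show ?thesis
      proof (cases "k = 0")
        case True
        then show ?thesis using g(2) by simp
      next
        case f: False
        then have "gate f ?ts ?w ! k = ?w ! k" using g(4)[of k] k False by blast
        then show ?thesis using f False assms by (auto simp: nth_Cons nth_append split: nat.splits)
      qed
    qed
  qed
qed

section \<open>Simulation\<close>

lemma cost_le_gate:
  fixes S :: "('a::finite list \<rightharpoonup> 'a list) set"
  assumes gen: "generating_set lepM_k1 S" and S: "pos_transpositions \<subseteq> S"
    and f: "cost_le S n (prefix_map (Suc (length ts)) f)" and ts: "\<forall>t\<in>set ts. length ts < t"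
  shows "cost_le S (n + 2 * length ts) (gate f ts)"
proof -
  have "cost_le S (1 * length [0..<length ts]) (exchange ts)"
    unfolding exchange_def
  proof (rule cost_le_fold[OF gen])
    fix i assume "i \<in> set [0..<length ts]"
    then have "i < length ts" "length ts < ts ! i" using ts by auto
    then show "cost_le S 1 (swap_at (Suc i) (ts ! i))" by (intro cost_le_swap_at[OF gen S]) simp
  qed
  then have e: "cost_le S (length ts) (exchange ts)" by simp
  have "cost_le S ((length ts + n) + length ts) (gate f ts)"
    unfolding gate_def by (intro cost_le_comp[OF gen] e f)
  then show ?thesis by (rule cost_le_mono) simp
qed

lemma fold_idle: "(\<And>p. p \<in> set ps \<Longrightarrow> G p s = s) \<Longrightarrow> fold G ps s = s"
  by (induction ps) auto

lemma fold_upt_single: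
  assumes "lo \<le> q" "q < hi" "\<And>p. lo \<le> p \<Longrightarrow> p < q \<Longrightarrow> G p s = s" "G q s = s'"
    "\<And>p. q < p \<Longrightarrow> p < hi \<Longrightarrow> G p s' = s'"
  shows "fold G [lo..<hi] s = s'"
proof -
  have "[lo..<hi] = [lo..<q] @ q # [Suc q..<hi]"
    using assms(1,2) by (metis upt_conv_Cons le_add_diff_inverse less_imp_le upt_add_eq_append)
  moreover have "fold G [lo..<q] s = s" by (rule fold_idle) (use assms(3) in auto)
  moreover have "fold G [Suc q..<hi] s' = s'" by (rule fold_idle) (use assms(5) in auto)
  ultimately show ?thesis using assms(4) by simp
qed

section \<open>Representatives changing a bounded prefix, and gates on padded words\<close>

text \<open>Bounding the prefix and its image together lets one gate of bounded width suffice and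
  limits the change of length to \<open>K\<close>.\<close>

definition bounded_by :: "nat \<Rightarrow> ('a list \<rightharpoonup> 'a list) \<Rightarrow> bool" where
  "bounded_by K \<phi> \<longleftrightarrow> (\<forall>x y. \<phi> x = Some y \<longrightarrow> (\<exists>p q w. x = p @ w \<and> y = q @ w \<and> \<phi> p = Some q \<and>
     length p \<le> K \<and> length q \<le> K))"

lemma bounded_by_mono: "bounded_by K \<phi> \<Longrightarrow> K \<le> L \<Longrightarrow> bounded_by L \<phi>"
  unfolding bounded_by_def by (meson order.trans)

lemma bounded_rep_ex:
  assumes "\<gamma> \<in> carrier M_k1"
  shows "\<exists>\<phi> K. fg_rep \<phi> \<gamma> \<and> bounded_by K \<phi>"
proof -
  obtain \<phi> where \<phi>: "\<gamma> = max_ext \<phi>" "fg_ri_hom \<phi>" using assms unfolding M_k1_def by auto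
  then obtain P where P: "finite P" "dom \<phi> = ideal_of P" and h: "ri_hom \<phi>"
    unfolding fg_ri_hom_def fg_right_ideal_def by blast
  \<comment> \<open>A sum over the finite set \<open>P\<close> dominates both lengths for every
    generator of the domain.\<close>
  define K where "K = (\<Sum>p\<in>P. length p + length (the (\<phi> p)))"
  have K: "length p + length (the (\<phi> p)) \<le> K" if "p \<in> P" for p
    unfolding K_def by (rule member_le_sum) (use that P(1) in auto)
  have "fg_rep \<phi> \<gamma>" unfolding fg_rep_def
    using max_ext_essential[OF h] h \<phi>(1) decided_by_ideal_of[OF P(2), of K] K add_leD1 by blast
  moreover have "bounded_by K \<phi>"
    unfolding bounded_by_def
  proof (intro allI impI)
    fix x y assume xy: "\<phi> x = Some y"
    then obtain p w where p: "p \<in> P" "x = p @ w" using P(2) unfolding ideal_of_def by blast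
    have "p \<in> dom \<phi>" using p(1) unfolding P(2) ideal_of_def by (auto intro: exI[of _ "[]"])
    then obtain q where q: "\<phi> p = Some q" by blast
    have "y = q @ w" using ri_hom_append[OF h q, of w] xy p(2) by simp
    then show "\<exists>p q w. x = p @ w \<and> y = q @ w \<and> \<phi> p = Some q \<and> length p \<le> K \<and> length q \<le> K"
      using p q K[OF p(1)] by (intro exI[of _ p] exI[of _ q] exI[of _ w]) auto
  qed
  ultimately show ?thesis by blast
qed

context
  fixes zero one :: "'a::finite"
  assumes neq: "zero \<noteq> one"
begin

definition enc :: "nat \<Rightarrow> 'a list \<Rightarrow> 'a list" where
  "enc n x = replicate n zero @ one # x"

text \<open>Scanning all possible positions of the marker \<open>one\<close>: the flag in front is \<open>one\<close> until the gate
  at the marker has fired, so neither a later letter \<open>one\<close> of the word nor a moved marker triggers a second gate.\<close>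

definition scan :: "('a list \<Rightarrow> 'a list) \<Rightarrow> (nat \<Rightarrow> nat list) \<Rightarrow> nat \<Rightarrow> nat \<Rightarrow> 'a list \<Rightarrow> 'a list" where
  "scan f ts lo hi = drop 1 \<circ> fold (\<lambda>p. gate f (ts p)) [lo..<hi] \<circ> (#) one"

text \<open>\<open>c\<close> is the index of the scanned cell p in \<open>ts p\<close>, and
  \<open>J\<close> bounds how far targets reach beyond p. Before the marker the scanned cell holds
  \<open>zero\<close>, after the firing the flag does, so exactly one gate acts.\<close>

lemma scan_enc:
  assumes ts: "\<And>p. lo \<le> p \<Longrightarrow> distinct (ts p) \<and> length (ts p) = m \<and> (\<forall>t\<in>set (ts p). m < t \<and> t \<le> p + J) \<and> ts p ! c = p"
    and c: "c < m"
    and idle: "\<And>u. length u = Suc m \<Longrightarrow> u ! 0 \<noteq> one \<or> u ! Suc c \<noteq> one \<Longrightarrow> f u = u"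
    and n: "lo \<le> Suc n" "Suc n < hi" and x: "hi + J \<le> length x" "m < hi"
    and fire: "gate f (ts (Suc n)) (one # enc n x) = zero # enc n' x'" "n' + length x' = n + length x"
  shows "scan f ts lo hi (enc n x) = enc n' x'"
proof -
  have idle': "gate f (ts p) s = s"
    if p: "lo \<le> p" "p < hi" and s: "s ! 0 \<noteq> one \<or> s ! p \<noteq> one" "length s = length (one # enc n x)" for p s
  proof -
    note tp = ts[OF p(1)]
    show ?thesis
    proof (rule gate_idle)
      show "f (s ! 0 # map ((!) s) (ts p)) = s ! 0 # map ((!) s) (ts p)"
        by (rule idle) (use s tp c in auto)
      show "length (ts p) < length s" using tp x s(2) unfolding enc_def by auto
      show "\<forall>t\<in>set (ts p). length (ts p) < t \<and> t < length s"
        using tp x s(2) p(2) unfolding enc_def by fastforce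
    qed (use tp in blast)
  qed
  have "fold (\<lambda>p. gate f (ts p)) [lo..<hi] (one # enc n x) = zero # enc n' x'"
  \<comment> \<open>The flag in front shifts the marker of \<open>enc n x\<close> to cell
    \<open>Suc n\<close>.\<close>
  proof (rule fold_upt_single[where G = "\<lambda>p. gate f (ts p)" and s' = "zero # enc n' x'", OF n _ fire(1)])
    fix p assume p: "lo \<le> p" "p < Suc n"
    \<comment> \<open>Cell 0 holds the flag \<open>one\<close>, so p must be shown positive before
      cell p is read as padding.\<close>
    have "ts p ! c \<in> set (ts p)" using ts[OF p(1)] c by (metis nth_mem)
    then have "m < p" using ts[OF p(1)] by metis
    then have "(one # enc n x) ! p \<noteq> one"
      using p(2) neq unfolding enc_def by (auto simp: nth_Cons nth_append split: nat.splits)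
    then show "gate f (ts p) (one # enc n x) = one # enc n x" using p n by (intro idle') auto
  next
    fix p assume "Suc n < p" "p < hi"
    then show "gate f (ts p) (zero # enc n' x') = zero # enc n' x'"
      using n neq fire(2) by (intro idle') (auto simp: enc_def)
  qed
  then show ?thesis unfolding scan_def by simp
qed

text \<open>The input is the flag, \<open>K\<close> padding cells, the marker and \<open>K\<close>
  letters. The padding cells are overwritten uninspected; whenever the gate does not fire it returns
  \<open>u\<close>, which keeps the length fixed as \<open>prefix_map_in_lepM_k1\<close>
  requires.\<close>

definition hom_gate :: "nat \<Rightarrow> ('a list \<rightharpoonup> 'a list) \<Rightarrow> 'a list \<Rightarrow> 'a list" where
  "hom_gate K \<phi> u = (if u ! 0 = one \<and> u ! Suc K = one then
     (case \<phi> (drop (K + 2) u) of None \<Rightarrow> u | Some y \<Rightarrow>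
       if length y \<le> 2 * K then zero # enc (2 * K - length y) y else u) else u)"

text \<open>The four cells are the flag, the marker and the two letters to be interchanged.\<close>

definition swap_gate :: "'a list \<Rightarrow> 'a list" where
  "swap_gate u = (if u ! 0 = one \<and> u ! 1 = one then [zero, one, u ! 3, u ! 2] else u)"

lemma length_hom_gate: "length u = Suc (Suc (2 * K)) \<Longrightarrow> length (hom_gate K \<phi> u) = Suc (Suc (2 * K))"
  unfolding hom_gate_def enc_def by (auto split: option.splits)

lemma length_swap_gate: "length u = 4 \<Longrightarrow> length (swap_gate u) = 4"
  unfolding swap_gate_def by auto

text \<open>The bound \<open>3 \<le> n\<close> keeps the three scratch cells inside the
  padding.\<close>

lemma swap_gate_enc:
  assumes "1 \<le> i" "i < j" "j \<le> length x" "3 \<le> n"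
  shows "gate swap_gate [Suc n, Suc n + i, Suc n + j] (one # enc n x) = zero # enc n (swap_at (i - 1) (j - 1) x)"
proof -
  let ?ts = "[Suc n, Suc n + i, Suc n + j]" let ?w = "one # enc n x"
  \<comment> \<open>With flag and marker in front, the k-th letter, counted from 1, sits at cell
    \<open>Suc n + k\<close>.\<close>
  have tail: "(b # enc n y) ! (Suc n + k) = y ! (k - 1)" if "1 \<le> k" for b k and y :: "'a list"
    using that unfolding enc_def by (cases k) (auto simp: nth_append)
  have mark: "(b # enc n y) ! Suc n = one" for b and y :: "'a list" unfolding enc_def by (auto simp: nth_append)
  have 1: "distinct ?ts" "\<forall>t\<in>set ?ts. length ?ts < t \<and> t < length ?w" "length ?ts < length ?w"
    using assms unfolding enc_def by auto
  have 2: "swap_gate (?w ! 0 # map (nth ?w) ?ts) = [zero, one, x ! (j - 1), x ! (i - 1)]"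
    unfolding swap_gate_def using mark tail[of i] tail[of j] assms by (simp add: numeral_3_eq_3 numeral_2_eq_2)
  have 3: "length [zero, one, x ! (j - 1), x ! (i - 1)] = Suc (length ?ts)" by simp
  note g = gate_nth[where f = swap_gate and w = ?w, OF 1 2 3]
  show ?thesis
  proof (rule nth_equalityI)
    show "length (gate swap_gate ?ts ?w) = length (zero # enc n (swap_at (i - 1) (j - 1) x))"
      using g(1) unfolding enc_def by simp
    fix k assume "k < length (gate swap_gate ?ts ?w)"
    then have k: "k < length ?w" using g(1) by simp
    consider "k = 0" | "k = Suc n" | "k = Suc n + i" | "k = Suc n + j" | "0 < k" "k \<notin> set ?ts" by auto
    then show "gate swap_gate ?ts ?w ! k = (zero # enc n (swap_at (i - 1) (j - 1) x)) ! k"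
    proof cases
      case 1
      then show ?thesis using g(2) by simp
    next
      case 2
      then show ?thesis using g(3)[of 0] mark by simp
    next
      case 3
      then show ?thesis using g(3)[of 1] tail[of i] assms
        by (simp add: swap_at_def nth_list_update)
    next
      case 4
      then show ?thesis using g(3)[of 2] tail[of j] assms
        by (simp add: swap_at_def nth_list_update numeral_2_eq_2)
    next
      case 5
      have "gate swap_gate ?ts ?w ! k = ?w ! k" using g(4)[OF 5(1) k 5(2)] .
      also have "\<dots> = (zero # enc n (swap_at (i - 1) (j - 1) x)) ! k"
      proof (cases "k \<le> n")
        case True
        then show ?thesis using 5(1) unfolding enc_def by (auto simp: nth_Cons nth_append split: nat.splits)
      next
        case False
        then obtain l where l: "k = Suc n + l" "1 \<le> l" using 5(2)
          by (metis Suc_leI le_iff_add list.set_intros(1) not_less_eq_eq add_0_right less_one not_le)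
        then have "x ! (l - 1) = swap_at (i - 1) (j - 1) x ! (l - 1)"
          using 5(2) k assms unfolding enc_def swap_at_def by (auto simp: nth_list_update)
        then show ?thesis using tail[OF l(2)] l(1) by simp
      qed
      finally show ?thesis .
    qed
  qed
qed

text \<open>The window takes the last \<open>K\<close> padding cells, the marker and
  \<open>K\<close> letters; \<open>3 * K + 1 \<le> n\<close> leaves \<open>2 * K + 1\<close> more
  padding cells as scratch space.\<close>

lemma hom_gate_enc:
  assumes "\<phi> (take K x) = Some y" "length y \<le> 2 * K" "K \<le> length x" "3 * K + 1 \<le> n"
  shows "gate (hom_gate K \<phi>) [Suc n - K..<Suc n - K + Suc (2 * K)] (one # enc n x)
    = zero # enc (n + K - length y) (y @ drop K x)"
proof -
  let ?v = "enc K (take K x)" let ?s = "replicate (n - K) zero"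
  have "replicate n zero = ?s @ replicate K zero"
    using assms(4) by (simp add: replicate_add[symmetric])
  then have w: "one # enc n x = one # ?s @ ?v @ drop K x" unfolding enc_def by simp
  have q: "Suc n - K = Suc (length ?s)" using assms(4) by simp
  have lv: "length ?v = Suc (2 * K)" using assms(3) unfolding enc_def by simp
  have "(one # ?v) ! Suc K = one" unfolding enc_def by (simp add: nth_append)
  moreover have "drop (K + 2) (one # ?v) = take K x" unfolding enc_def by simp
  ultimately have f: "hom_gate K \<phi> (one # ?v) = zero # enc (2 * K - length y) y"
    unfolding hom_gate_def using assms(1,2) by simp
  have "gate (hom_gate K \<phi>) [Suc (length ?s)..<Suc (length ?s) + Suc (2 * K)] (one # ?s @ ?v @ drop K x)
      = zero # ?s @ enc (2 * K - length y) y @ drop K x"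
    by (rule gate_window[where f = "hom_gate K \<phi>" and a = one and v = ?v, OF f lv]) (use assms in \<open>auto simp: enc_def\<close>)
  also have "\<dots> = zero # enc ((n - K) + (2 * K - length y)) (y @ drop K x)"
    unfolding enc_def by (simp add: replicate_add)
  also have "(n - K) + (2 * K - length y) = n + K - length y" using assms by simp
  finally show ?thesis unfolding w q .
qed

section \<open>Simulation of one generator and of a whole word\<close>

text \<open>The padding absorbs the change of length, so the encoded word keeps its total length.
  \<open>N\<close> may depend on \<open>hi\<close>, since only values on long words count.\<close>

definition simulates :: "nat \<Rightarrow> nat \<Rightarrow> nat \<Rightarrow> ('a list \<Rightarrow> 'a list) \<Rightarrow> ('a list \<rightharpoonup> 'a list) \<Rightarrow> bool" where
  "simulates K lo hi F \<phi> \<longleftrightarrow> (\<exists>N. \<forall>x y. N \<le> length x \<longrightarrow> \<phi> x = Some y \<longrightarrow>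
     length y \<le> length x + K \<and> length x \<le> length y + K \<and>
     (\<forall>n. lo \<le> Suc n \<longrightarrow> Suc n < hi \<longrightarrow> F (enc n x) = enc (n + length x - length y) y))"

text \<open>Although \<open>i\<close> and \<open>j\<close> are unbounded, each gate touches three
  cells besides the flag, so the cost of the scan is independent of them; only the threshold on the
  length of x grows with \<open>j\<close>.\<close>

lemma scan_simulates_pos_transposition:
  assumes "1 \<le> i" "i < j" "4 \<le> lo" "lo < hi"
  shows "simulates K lo hi (scan swap_gate (\<lambda>p. [p, p + i, p + j]) lo hi) (pos_transposition i j)"
  unfolding simulates_def
proof (intro exI[of _ "hi + j"] allI impI)
  fix x y :: "'a list"
  assume x: "hi + j \<le> length x" "pos_transposition i j x = Some y"
  have y: "y = swap_at (i - 1) (j - 1) x"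
    using x by (auto simp: pos_transposition_swap_at split: if_splits)
  have "scan swap_gate (\<lambda>p. [p, p + i, p + j]) lo hi (enc n x) = enc n y"
    if n: "lo \<le> Suc n" "Suc n < hi" for n
  proof (rule scan_enc[where m = 3 and c = 0 and J = j])
    show "gate swap_gate [Suc n, Suc n + i, Suc n + j] (one # enc n x) = zero # enc n y"
      unfolding y by (rule swap_gate_enc) (use assms x n in auto)
    show "swap_gate u = u" if "length u = Suc 3" "u ! 0 \<noteq> one \<or> u ! Suc 0 \<noteq> one" for u
      using that unfolding swap_gate_def by auto
  qed (use assms n x y in auto)
  then show "length y \<le> length x + K \<and> length x \<le> length y + K \<and>
     (\<forall>n. lo \<le> Suc n \<longrightarrow> Suc n < hi \<longrightarrow> scan swap_gate (\<lambda>p. [p, p + i, p + j]) lo hi (enc n x)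
       = enc (n + length x - length y) y)" using y by simp
qed

lemma scan_simulates_hom:
  assumes \<phi>: "ri_hom \<phi>" "bounded_by K \<phi>" and lo: "3 * K + 2 \<le> lo" "lo < hi"
  shows "simulates K lo hi (scan (hom_gate K \<phi>) (\<lambda>p. [p - K..<p - K + Suc (2 * K)]) lo hi) \<phi>"
  unfolding simulates_def
proof (intro exI[of _ "hi + K"] allI impI)
  let ?ts = "\<lambda>p. [p - K..<p - K + Suc (2 * K)]"
  fix x y :: "'a list"
  assume x: "hi + K \<le> length x" "\<phi> x = Some y"
  then obtain p q w where p: "x = p @ w" "y = q @ w" "\<phi> p = Some q" "length p \<le> K" "length q \<le> K"
    using \<phi>(2) unfolding bounded_by_def by blast
  \<comment> \<open>The prefix p is completed to the \<open>K\<close> letters that the gate reads,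
    and v is their image.\<close>
  define v where "v = q @ take (K - length p) w"
  have tk: "take K x = p @ take (K - length p) w" using p(1,4) by simp
  have v: "\<phi> (take K x) = Some v" unfolding tk v_def by (rule ri_hom_append[OF \<phi>(1) p(3)])
  have yv: "y = v @ drop K x" unfolding v_def p(1,2) using p(4) by (simp add: append_take_drop_id)
  have lv: "length v \<le> 2 * K" unfolding v_def using p(5) by simp
  have "scan (hom_gate K \<phi>) ?ts lo hi (enc n x) = enc (n + length x - length y) y"
    if n: "lo \<le> Suc n" "Suc n < hi" for n
  proof -
    have l: "n + length x - length y = n + K - length v" using yv x(1) by simp
    show ?thesis unfolding l
    proof (rule scan_enc[where m = "Suc (2 * K)" and c = K and J = K])
      show "gate (hom_gate K \<phi>) (?ts (Suc n)) (one # enc n x) = zero # enc (n + K - length v) y"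
        unfolding yv by (rule hom_gate_enc) (use v lv x n lo in auto)
      show "hom_gate K \<phi> u = u" if "length u = Suc (Suc (2 * K))" "u ! 0 \<noteq> one \<or> u ! Suc K \<noteq> one" for u
        using that unfolding hom_gate_def by auto
      show "n + K - length v + length y = n + length x" using yv x(1) lv n lo by simp
      fix r assume r: "lo \<le> r"
      have "?ts r ! K = r" using r lo by (simp add: nth_upt del: upt_Suc)
      then show "distinct (?ts r) \<and> length (?ts r) = Suc (2 * K) \<and>
          (\<forall>t\<in>set (?ts r). Suc (2 * K) < t \<and> t \<le> r + K) \<and> ?ts r ! K = r"
        using r lo by (auto simp del: upt_Suc)
    qed (use n x lo in auto)
  qed
  then show "length y \<le> length x + K \<and> length x \<le> length y + K \<and>
     (\<forall>n. lo \<le> Suc n \<longrightarrow> Suc n < hi \<longrightarrow> scan (hom_gate K \<phi>) ?ts lo hi (enc n x)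
       = enc (n + length x - length y) y)" using p by simp
qed

context
  fixes S :: "('a list \<rightharpoonup> 'a list) set"
  assumes gen: "generating_set lepM_k1 S" and S: "pos_transpositions \<subseteq> S"
begin

lemma cost_le_scan:
  assumes f: "cost_le S C (prefix_map (Suc m) f)" "cost_le S C ((#) one)" "cost_le S C (drop 1)"
    and ts: "\<And>p. lo \<le> p \<Longrightarrow> length (ts p) = m \<and> (\<forall>t\<in>set (ts p). m < t)"
  shows "cost_le S (2 * C + (C + 2 * m) * (hi - lo)) (scan f ts lo hi)"
proof -
  have "cost_le S ((C + 2 * m) * length [lo..<hi]) (fold (\<lambda>p. gate f (ts p)) [lo..<hi])"
  proof (rule cost_le_fold[OF gen])
    fix p assume "p \<in> set [lo..<hi]"
    then have "length (ts p) = m" "\<forall>t\<in>set (ts p). m < t" using ts by auto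
    then show "cost_le S (C + 2 * m) (gate f (ts p))" using cost_le_gate[OF gen S, of C "ts p" f] f(1) by simp
  qed
  then have "cost_le S ((C + (C + 2 * m) * (hi - lo)) + C) (scan f ts lo hi)"
    unfolding scan_def by (intro cost_le_comp[OF gen] f) simp
  then show ?thesis by (rule cost_le_mono) simp
qed

text \<open>Each generator shifts the padding by at most \<open>K\<close>, so margins of
  \<open>K * length ws\<close> around the starting position of the marker keep it in the scanned
  range.\<close>

lemma cost_le_run:
  assumes "\<And>g. g \<in> set ws \<Longrightarrow> \<exists>F. cost_le S C F \<and> simulates K lo hi F (\<rho> g)"
    and "0 < lo" "lo + K * length ws \<le> Suc B" "Suc B + K * length ws < hi"
  shows "\<exists>F N. cost_le S (C * length ws) F \<and> (\<forall>x y. N \<le> length x \<longrightarrow> run \<rho> ws x = Some y \<longrightarrow>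
     length y \<le> length x + K * length ws \<and> length x \<le> length y + K * length ws \<and>
     F (enc B x) = enc (B + length x - length y) y)"
  using assms
proof (induction ws)
  case Nil
  then show ?case using cost_le_id[of S] unfolding id_def by (intro exI[of _ "\<lambda>w. w"] exI[of _ 0]) simp
next
  case (Cons g ws)
  let ?k = "K * length ws"
  have "\<exists>F N. cost_le S (C * length ws) F \<and> (\<forall>x y. N \<le> length x \<longrightarrow> run \<rho> ws x = Some y \<longrightarrow>
     length y \<le> length x + ?k \<and> length x \<le> length y + ?k \<and>
     F (enc B x) = enc (B + length x - length y) y)"
    by (rule Cons.IH) (use Cons.prems in auto)
  then obtain F N where F: "cost_le S (C * length ws) F"
    and FN: "\<And>x y. N \<le> length x \<Longrightarrow> run \<rho> ws x = Some y \<Longrightarrow>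
     length y \<le> length x + ?k \<and> length x \<le> length y + ?k \<and>
     F (enc B x) = enc (B + length x - length y) y" by blast
  obtain G where G: "cost_le S C G" "simulates K lo hi G (\<rho> g)" using Cons.prems(1) by auto
  then obtain M where GM: "\<And>x y. M \<le> length x \<Longrightarrow> \<rho> g x = Some y \<Longrightarrow>
     length y \<le> length x + K \<and> length x \<le> length y + K \<and>
     (\<forall>n. lo \<le> Suc n \<longrightarrow> Suc n < hi \<longrightarrow> G (enc n x) = enc (n + length x - length y) y)"
    unfolding simulates_def by blast
  have k: "K * length (g # ws) = K + ?k" by simp
  have "length y \<le> length x + K * length (g # ws) \<and> length x \<le> length y + K * length (g # ws) \<and>
     (G \<circ> F) (enc B x) = enc (B + length x - length y) y"
    if x: "N + M + ?k \<le> length x" and y: "run \<rho> (g # ws) x = Some y" for x y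
  proof -
    obtain t where t: "run \<rho> ws x = Some t" "\<rho> g t = Some y" using y by (auto simp: map_comp_Some_iff)
    have 1: "length t \<le> length x + ?k" "length x \<le> length t + ?k"
      "F (enc B x) = enc (B + length x - length t) t" using FN[OF _ t(1)] x by auto
    have Mt: "M \<le> length t" using 1 x by simp
    note 2 = GM[OF Mt t(2)]
    \<comment> \<open>The padding left by \<open>ws\<close> must lie in the range scanned for
      \<open>g\<close>. The lower margin also keeps the truncated subtraction below exact.\<close>
    have b: "lo \<le> Suc (B + length x - length t)" "Suc (B + length x - length t) < hi"
      using Cons.prems(2,3,4) 1(1,2) unfolding k by linarith+
    have "B + length x - length t + length t - length y = B + length x - length y"
      using Cons.prems(2,3) 1(1) unfolding k by linarith
    then have "(G \<circ> F) (enc B x) = enc (B + length x - length y) y" using 1(3) 2 b by simp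
    then show ?thesis using 1 2 unfolding k by linarith
  qed
  moreover have "cost_le S (C * length (g # ws)) (G \<circ> F)"
    using cost_le_comp[OF gen G(1) F] by simp
  ultimately show ?case by blast
qed

end

end

section \<open>The quadratic bound\<close>

theorem theorem2p9:
  fixes \<Gamma>\<^sub>M \<Gamma>\<^sub>l\<^sub>e\<^sub>p :: "('a::{finite,linorder} list \<rightharpoonup> 'a list) set"
  assumes "CARD('a) \<ge> 2"
    and "finite \<Gamma>\<^sub>M" and "finite \<Gamma>\<^sub>l\<^sub>e\<^sub>p"
    and "generating_set M_k1 (\<Gamma>\<^sub>M \<union> pos_transpositions)"
    and "generating_set lepM_k1 (\<Gamma>\<^sub>l\<^sub>e\<^sub>p \<union> pos_transpositions)"
  shows "\<exists>c::real. c \<ge> 1 \<and> (\<forall>x\<in>carrier (lepM_k1 :: ('a list \<rightharpoonup> 'a list) monoid).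
     real (word_length lepM_k1 (\<Gamma>\<^sub>l\<^sub>e\<^sub>p \<union> pos_transpositions) x)
       \<le> c * (real (word_length M_k1 (\<Gamma>\<^sub>M \<union> pos_transpositions) x))\<^sup>2)"
proof -
  let ?S = "\<Gamma>\<^sub>l\<^sub>e\<^sub>p \<union> pos_transpositions" and ?T = "\<Gamma>\<^sub>M \<union> pos_transpositions"
  note gen = assms(5)
  have S: "pos_transpositions \<subseteq> ?S" by blast
  obtain zero one :: 'a where neq: "zero \<noteq> one"
    using assms(1) card_le_Suc0_iff_eq[of "UNIV :: 'a set"] by fastforce
  have carr: "?T \<subseteq> carrier M_k1" using assms(4) unfolding generating_set_def by blast
  then have "\<forall>\<gamma>\<in>\<Gamma>\<^sub>M. \<exists>\<phi> K. fg_rep \<phi> \<gamma> \<and> bounded_by K \<phi>" using bounded_rep_ex by blast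
  then obtain r b where rb: "\<And>\<gamma>. \<gamma> \<in> \<Gamma>\<^sub>M \<Longrightarrow> fg_rep (r \<gamma>) \<gamma> \<and> bounded_by (b \<gamma>) (r \<gamma>)" by metis
  \<comment> \<open>Transpositions represent themselves: they reach unboundedly far, so no common
    \<open>K\<close> would cover all of them.\<close>
  define \<rho> where "\<rho> g = (if g \<in> pos_transpositions then g else r g)" for g
  have rep: "fg_rep (\<rho> g) g" if "g \<in> ?T" for g
    using that rb fg_rep_pos_transposition unfolding \<rho>_def pos_transpositions_def by auto
  \<comment> \<open>One bound for the finite set \<open>\<Gamma>\<^sub>M\<close>, made positive by
    \<open>Suc\<close>.\<close>
  define K where "K = Suc (\<Sum>\<gamma>\<in>\<Gamma>\<^sub>M. b \<gamma>)"
  have bK: "bounded_by K (r \<gamma>)" if "\<gamma> \<in> \<Gamma>\<^sub>M" for \<gamma>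
  proof (rule bounded_by_mono)
    show "bounded_by (b \<gamma>) (r \<gamma>)" using rb that by blast
    show "b \<gamma> \<le> K" unfolding K_def using member_le_sum[of \<gamma> \<Gamma>\<^sub>M b] that assms(2) by simp
  qed
  let ?hg = "\<lambda>\<gamma>. prefix_map (Suc (Suc (2 * K))) (hom_gate zero one K (r \<gamma>))"
  have "\<exists>n. cost_le ?S n (?hg \<gamma>)" for \<gamma>
    by (rule cost_le_prefix_map[OF gen]) (rule length_hom_gate[OF neq])
  then obtain a where a: "\<And>\<gamma>. cost_le ?S (a \<gamma>) (?hg \<gamma>)" by metis
  have "\<exists>n. cost_le ?S n (prefix_map (Suc 3) (swap_gate zero one))"
    by (rule cost_le_prefix_map[OF gen, where l = 4]) (simp add: length_swap_gate[OF neq])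
  then obtain a1 where a1: "cost_le ?S a1 (prefix_map (Suc 3) (swap_gate zero one))" by blast
  have push: "prefix_map 0 (\<lambda>_. [s]) = (#) s" for s :: 'a by (rule ext) (simp add: prefix_map_def)
  have pop: "prefix_map 1 (\<lambda>_. []) = (drop 1 :: 'a list \<Rightarrow> _)" by (rule ext) (simp add: prefix_map_def)
  obtain a2 where a2: "cost_le ?S a2 ((#) zero)"
    using cost_le_prefix_map[OF gen, of 0 "\<lambda>_. [zero]" 1] push by auto
  obtain a3 where a3: "cost_le ?S a3 ((#) one)"
    using cost_le_prefix_map[OF gen, of 0 "\<lambda>_. [one]" 1] push by auto
  obtain a4 where a4: "cost_le ?S a4 (drop 1)"
    using cost_le_prefix_map[OF gen, of 1 "\<lambda>_. []" 0] pop by auto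
  \<comment> \<open>One cost for all gates and for adding or removing a letter, by finiteness of
    \<open>\<Gamma>\<^sub>M\<close>.\<close>
  define C where "C = Suc ((\<Sum>\<gamma>\<in>\<Gamma>\<^sub>M. a \<gamma>) + a1 + a2 + a3 + a4)"
  have C: "cost_le ?S C (prefix_map (Suc 3) (swap_gate zero one))" "cost_le ?S C ((#) zero)"
    "cost_le ?S C ((#) one)" "cost_le ?S C (drop 1)"
    using a1 a2 a3 a4 by (auto elim!: cost_le_mono simp: C_def)
  have Ca: "cost_le ?S C (?hg \<gamma>)" if "\<gamma> \<in> \<Gamma>\<^sub>M" for \<gamma>
    using a[of \<gamma>] member_le_sum[of \<gamma> \<Gamma>\<^sub>M a] that assms(2) by (elim cost_le_mono) (simp add: C_def)
  \<comment> \<open>Cost of one homomorphism gate: \<open>C\<close> for the prefix map, and two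
    exchanges of \<open>2 * K + 1\<close> swaps each.\<close>
  define E where "E = C + 2 * Suc (2 * K)"
  have step: "\<exists>F. cost_le ?S (2 * C + E * (hi - lo)) F \<and> simulates zero one K lo hi F (\<rho> g)"
    if g: "g \<in> ?T" and lo: "3 * K + 2 \<le> lo" "lo < hi" for g lo hi
  proof (cases "g \<in> pos_transpositions")
    case True
    then obtain i j where ij: "g = pos_transposition i j" "1 \<le> i" "i < j"
      unfolding pos_transpositions_def by blast
    have "cost_le ?S (2 * C + (C + 2 * 3) * (hi - lo)) (scan one (swap_gate zero one) (\<lambda>p. [p, p + i, p + j]) lo hi)"
      by (rule cost_le_scan[OF neq gen S C(1,3,4)]) (use lo K_def in auto)
    \<comment> \<open>\<open>1 \<le> K\<close> gives \<open>3 \<le> Suc (2 * K)\<close>, so gates on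
      three cells cost no more.\<close>
    moreover have "2 * C + (C + 2 * 3) * (hi - lo) \<le> 2 * C + E * (hi - lo)"
      unfolding E_def K_def by (intro add_mono mult_mono) auto
    ultimately have "cost_le ?S (2 * C + E * (hi - lo)) (scan one (swap_gate zero one) (\<lambda>p. [p, p + i, p + j]) lo hi)"
      by (rule cost_le_mono)
    moreover have "simulates zero one K lo hi (scan one (swap_gate zero one) (\<lambda>p. [p, p + i, p + j]) lo hi) (\<rho> g)"
      using scan_simulates_pos_transposition[OF neq ij(2,3), of lo hi K] lo True ij(1) unfolding \<rho>_def K_def by simp
    ultimately show ?thesis by blast
  next
    case False
    then have g: "g \<in> \<Gamma>\<^sub>M" "\<rho> g = r g" using g unfolding \<rho>_def by auto
    let ?F = "scan one (hom_gate zero one K (r g)) (\<lambda>p. [p - K..<p - K + Suc (2 * K)]) lo hi"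
    have "cost_le ?S (2 * C + E * (hi - lo)) ?F"
      unfolding E_def by (rule cost_le_scan[OF neq gen S Ca[OF g(1)] C(3,4)]) (use lo in \<open>auto simp del: upt_Suc\<close>)
    moreover have "simulates zero one K lo hi ?F (\<rho> g)"
      unfolding g(2) using rb[OF g(1)] lo bK[OF g(1)] unfolding fg_rep_def
      by (intro scan_simulates_hom[OF neq]) auto
    ultimately show ?thesis by blast
  qed
  \<comment> \<open>The factor 18 is 13 + 5, from the linear and the quadratic terms of the final
    estimate.\<close>
  define c where "c = 18 * K * E"
  have bound: "word_length lepM_k1 ?S x \<le> c * (word_length M_k1 ?T x)\<^sup>2" if x: "x \<in> carrier lepM_k1" for x
  proof -
    have "x \<in> word_value M_k1 ` lists ?T" using lepM_k1_elem(1)[OF x] assms(4) unfolding generating_set_def by simp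
    then have "\<exists>n. \<exists>ws\<in>lists ?T. length ws = n \<and> word_value M_k1 ws = x" by blast
    from LeastI_ex[OF this] obtain ws where ws: "ws \<in> lists ?T" "length ws = word_length M_k1 ?T x"
      "word_value M_k1 ws = x" unfolding word_length_def by blast
    define n where "n = length ws"
    show ?thesis
    proof (cases "n = 0")
      \<comment> \<open>The claimed bound is 0 here, so x must be the value of the empty word over
        the submonoid generators as well.\<close>
      case True
      then have "ws = []" unfolding n_def by simp
      then have "x = Some" using ws(3) by simp
      moreover have "ev_rep Some id" unfolding ev_rep_def by auto
      ultimately have "word_length lepM_k1 ?S x \<le> 0"
        using word_length_le_cost[OF gen x _ cost_le_id] by simp
      then show ?thesis by simp
    next
      case False
      \<comment> \<open>\<open>lo\<close> gives the room that \<open>hom_gate_enc\<close> asks for.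
        The marker starts at \<open>Suc B = lo + K * n\<close>, and \<open>hi\<close> is just above
        \<open>Suc B + K * n\<close>.\<close>
      define B lo hi where "B = K * n + 3 * K + 1" and "lo = 3 * K + 2" and "hi = 3 * K + 3 + 2 * (K * n)"
      have "\<exists>F N. cost_le ?S ((2 * C + E * (hi - lo)) * length ws) F \<and> (\<forall>x y. N \<le> length x \<longrightarrow> run \<rho> ws x = Some y \<longrightarrow>
          length y \<le> length x + K * length ws \<and> length x \<le> length y + K * length ws \<and>
          F (enc zero one B x) = enc zero one (B + length x - length y) y)"
        by (rule cost_le_run[OF neq gen S step]) (use ws(1) in \<open>auto simp: B_def lo_def hi_def n_def\<close>)
      then obtain F N where F: "cost_le ?S ((2 * C + E * (hi - lo)) * n) F"
        and FN: "\<And>x y. N \<le> length x \<Longrightarrow> run \<rho> ws x = Some y \<Longrightarrow>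
          length y \<le> length x + K * n \<and> length x \<le> length y + K * n \<and>
          F (enc zero one B x) = enc zero one (B + length x - length y) y" unfolding n_def by blast
      obtain X M d where X: "\<And>w. M \<le> length w \<Longrightarrow> x w = Some (X w) \<and> int (length (X w)) = int (length w) + d"
        using lepM_k1_elem(2)[OF x] by blast
      then have xX: "ev_rep x X" unfolding ev_rep_def by blast
      have "fg_rep (run \<rho> ws) x" using fg_rep_run[of ws \<rho>] rep ws(1,3) by auto
      then have "ev_rep (run \<rho> ws) X" using xX by (rule fg_rep_ev_rep)
      then obtain M' where M': "\<And>w. M' \<le> length w \<Longrightarrow> run \<rho> ws w = Some (X w)" unfolding ev_rep_def by blast
      \<comment> \<open>The final padding. It is the same for all long inputs because
        \<open>d\<close> is constant, which is where length-equality preservation of x is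
        decisive.\<close>
      define D where "D = nat (int B - d)"
      have w: "F (enc zero one B w) = enc zero one D (X w) \<and> D \<le> B + K * n" if w: "max N (max M M') \<le> length w" for w
      proof -
        have 1: "length (X w) \<le> length w + K * n" "length w \<le> length (X w) + K * n"
          "F (enc zero one B w) = enc zero one (B + length w - length (X w)) (X w)"
          using FN[OF _ M'[of w]] w by auto
        have "int (length (X w)) = int (length w) + d" using X w by simp
        then have "B + length w - length (X w) = D" using 1(1) unfolding D_def B_def by linarith
        then show ?thesis using 1 by auto
      qed
      \<comment> \<open>From right to left: write the marker, put \<open>B\<close> zeros before it,
        simulate the word, delete the \<open>D\<close> padding letters and the marker.\<close>
      define G where "G = (drop 1 ^^ Suc D) \<circ> F \<circ> (((#) zero) ^^ B) \<circ> (#) one"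
      have push: "((#) zero ^^ m) v = replicate m zero @ v" for m v by (induction m) auto
      have pop: "(drop 1 ^^ m) (v :: 'a list) = drop m v" for m v
        by (induction m) (auto simp: drop_drop)
      have "x w = Some (G w)" if w': "max N (max M M') \<le> length w" for w
      proof -
        have "G w = (drop 1 ^^ Suc D) (F (enc zero one B w))"
          unfolding G_def comp_def push enc_def[OF neq] ..
        also have "\<dots> = drop (Suc D) (enc zero one D (X w))" unfolding pop using w[OF w'] by simp
        also have "\<dots> = X w" unfolding enc_def[OF neq] by simp
        finally show ?thesis using X w' by simp
      qed
      then have xG: "ev_rep x G" unfolding ev_rep_def by blast
      \<comment> \<open>\<open>D\<close> does not depend on the input, so any sufficiently long word
        yields the bound.\<close>
      have D: "D \<le> B + K * n" using w[of "replicate (max N (max M M')) zero"] by simp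
      \<comment> \<open>Only the \<open>n\<close> scans over \<open>hi - lo\<close> positions
        contribute quadratically; writing and deleting the padding is linear in
        \<open>n\<close>.\<close>
      have "cost_le ?S (((C * Suc D + (2 * C + E * (hi - lo)) * n) + C * B) + C) G"
        unfolding G_def by (intro cost_le_comp[OF gen] cost_le_funpow[OF gen] C F)
      then have "word_length lepM_k1 ?S x \<le> ((C * Suc D + (2 * C + E * (hi - lo)) * n) + C * B) + C"
        by (rule word_length_le_cost[OF gen x xG])
      also have "\<dots> \<le> c * n\<^sup>2"
      proof -
        have n1: "1 \<le> n" and K1: "1 \<le> K" and CE: "C \<le> E" using False unfolding K_def E_def by auto
        have Kn: "1 \<le> K * n" using n1 K1 by (metis mult_le_mono nat_mult_1)
        have KK: "K \<le> K * n" using n1 by simp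
        have nn: "K * n \<le> K * n\<^sup>2" using n1 by (simp add: power2_eq_square)
        have "Suc D \<le> 7 * (K * n)" "B \<le> 5 * (K * n)" "hi - lo \<le> 3 * (K * n)"
          using D Kn KK unfolding B_def hi_def lo_def by linarith+
        then have le: "C * Suc D \<le> E * (7 * (K * n))" "C * B \<le> E * (5 * (K * n))"
          "E * (hi - lo) \<le> E * (3 * (K * n))" "C * 1 \<le> E * (K * n)"
          using mult_le_mono[OF CE] Kn by (auto simp only: mult_le_mono2)
        have "(2 * C + E * (hi - lo)) * n \<le> (5 * (E * (K * n))) * n"
          by (intro mult_le_mono1) (use le(3,4) in linarith)
        then have "((C * Suc D + (2 * C + E * (hi - lo)) * n) + C * B) + C
            \<le> 13 * (E * (K * n)) + (5 * (E * (K * n))) * n" using le(1,2,4) by linarith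
        also have "\<dots> = 13 * E * (K * n) + 5 * E * (K * n\<^sup>2)" by (simp add: power2_eq_square algebra_simps)
        also have "\<dots> \<le> 13 * E * (K * n\<^sup>2) + 5 * E * (K * n\<^sup>2)" by (rule add_mono[OF mult_le_mono2[OF nn] order_refl])
        also have "\<dots> = c * n\<^sup>2" unfolding c_def by (simp add: algebra_simps)
        finally show ?thesis .
      qed
      finally show ?thesis using ws(2) n_def by simp
    qed
  qed
  have "1 \<le> c" unfolding c_def K_def E_def by simp
  moreover have "real (word_length lepM_k1 ?S x) \<le> real c * (real (word_length M_k1 ?T x))\<^sup>2"
    if "x \<in> carrier lepM_k1" for x
    using bound[OF that] by (metis of_nat_le_iff of_nat_mult of_nat_power)
  ultimately show ?thesis by (intro exI[of _ "real c"]) auto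
qed

end
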